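(* Let $n_1,\ldots,n_\ell$ and $m$ be positive integers, and let $\varphi\colon M_{n_1}(\mathbb{C})\oplus\cdots\oplus M_{n_\ell}(\mathbb{C})\to M_m(\mathbb{C})$ be a linear map that is completely positive and completely contractive. Then $\varphi$ is a homomorphism if and only if its adjusted Choi matrix $$\tilde c_\varphi = \sum_{k=1}^{\ell}\sum_{i,j=1}^{n_k}\frac{1}{n_k}\,\varphi(e_{ijk})\otimes e_{ijk}$$ is a projection.
   Context: For $1\le k\le \ell$ and $1\le i,j\le n_k$, $e_{ijk}=0_{n_1}\oplus\cdots\oplus 0_{n_{k-1}}\oplus e_{ij}\oplus 0_{n_{k+1}}\oplus\cdots\oplus 0_{n_\ell}$, where $e_{ij}\in M_{n_k}(\mathbb{C})$ is the standard matrix unit. The adjusted Choi matrix is an element of $M_m(\mathbb{C})\otimes(M_{n_1}(\mathbb{C})\oplus\cdots\oplus M_{n_\ell}(\mathbb{C}))$. "Projection" means self-adjoint idempotent. "Homomorphism" means $*$-homomorphism (not necessarily unital); since completely positive maps are $*$-preserving, this amounts to multiplicativity. "Completely contractive" means that $\varphi\otimes\mathrm{id}_{M_r(\mathbb{C})}$ has operator norm at most $1$ for every positive integer $r$. *)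

theory Defs
  imports "Jordan_Normal_Form.Schur_Decomposition" "HOL-Analysis.L2_Norm"
begin

definition mat_unit :: "nat \<Rightarrow> nat \<Rightarrow> nat \<Rightarrow> complex mat" where
  "mat_unit n i j = mat n n (\<lambda>(p, q). if p = i \<and> q = j then 1 else 0)"

text \<open>Kronecker product, realising the tensor product of matrix algebras: the index of
  \<open>\<complex>\<^sup>a \<otimes> \<complex>\<^sup>b\<close> belonging to the pair \<open>(i, p)\<close> is \<open>i * b + p\<close>.\<close>

definition kron :: "complex mat \<Rightarrow> complex mat \<Rightarrow> complex mat" where
  "kron A B = mat (dim_row A * dim_row B) (dim_col A * dim_col B)
     (\<lambda>(i, j). A $$ (i div dim_row B, j div dim_col B) * B $$ (i mod dim_row B, j mod dim_col B))"

text \<open>The algebra \<open>M\<^bsub>n 0\<^esub> \<oplus> \<dots> \<oplus> M\<^bsub>n (l-1)\<^esub>\<close> is the *-subalgebra of block diagonal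
  matrices of \<open>M\<^sub>N\<close> with \<open>N = n 0 + \<dots> + n (l-1)\<close>.  Its product, adjoint, norm and positive
  elements, and those of its tensor products with full matrix algebras, are the ones inherited
  from the ambient full matrix algebra.  All indices are 0-based.\<close>

definition block_sum :: "nat \<Rightarrow> (nat \<Rightarrow> complex mat) \<Rightarrow> complex mat" where
  "block_sum l a = diag_block_mat (map a [0..<l])"

definition block_alg :: "nat \<Rightarrow> (nat \<Rightarrow> nat) \<Rightarrow> complex mat set" where
  "block_alg l n = {block_sum l a | a. \<forall>k<l. a k \<in> carrier_mat (n k) (n k)}"

definition block_dim :: "nat \<Rightarrow> (nat \<Rightarrow> nat) \<Rightarrow> nat" where
  "block_dim l n = (\<Sum>k<l. n k)"

definition block_unit :: "nat \<Rightarrow> (nat \<Rightarrow> nat) \<Rightarrow> nat \<Rightarrow> nat \<Rightarrow> nat \<Rightarrow> complex mat" where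
  "block_unit l n i j k =
     block_sum l (\<lambda>k'. if k' = k then mat_unit (n k) i j else 0\<^sub>m (n k') (n k'))"

definition linear_on_block_alg ::
  "nat \<Rightarrow> (nat \<Rightarrow> nat) \<Rightarrow> nat \<Rightarrow> (complex mat \<Rightarrow> complex mat) \<Rightarrow> bool" where
  "linear_on_block_alg l n m \<phi> \<longleftrightarrow>
     (\<forall>x \<in> block_alg l n. \<phi> x \<in> carrier_mat m m) \<and>
     (\<forall>x \<in> block_alg l n. \<forall>y \<in> block_alg l n. \<phi> (x + y) = \<phi> x + \<phi> y) \<and>
     (\<forall>c. \<forall>x \<in> block_alg l n. \<phi> (c \<cdot>\<^sub>m x) = c \<cdot>\<^sub>m \<phi> x)"

definition star_homomorphism ::
  "nat \<Rightarrow> (nat \<Rightarrow> nat) \<Rightarrow> nat \<Rightarrow> (complex mat \<Rightarrow> complex mat) \<Rightarrow> bool" where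
  "star_homomorphism l n m \<phi> \<longleftrightarrow>
     linear_on_block_alg l n m \<phi> \<and>
     (\<forall>x \<in> block_alg l n. \<forall>y \<in> block_alg l n. \<phi> (x * y) = \<phi> x * \<phi> y) \<and>
     (\<forall>x \<in> block_alg l n. \<phi> (mat_adjoint x) = mat_adjoint (\<phi> x))"

text \<open>The complex order makes \<open>0 \<le> z\<close> mean that \<open>z\<close> is real and nonnegative, so positive
  matrices are in particular self-adjoint.\<close>

definition positive_mat :: "complex mat \<Rightarrow> bool" where
  "positive_mat A \<longleftrightarrow> square_mat A \<and> (\<forall>v \<in> carrier_vec (dim_col A). 0 \<le> (A *\<^sub>v v) \<bullet>c v)"

definition l2_norm :: "complex vec \<Rightarrow> real" where
  "l2_norm v = L2_set (\<lambda>i. cmod (v $ i)) {..<dim_vec v}"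

definition op_norm :: "complex mat \<Rightarrow> real" where
  "op_norm A = (SUP v \<in> {v \<in> carrier_vec (dim_col A). l2_norm v \<le> 1}. l2_norm (A *\<^sub>v v))"

text \<open>The supremum in \<open>op_norm\<close> is over a bounded nonempty set, so it is not a junk value.\<close>

lemma op_norm_bdd_above:
  "bdd_above ((\<lambda>v. l2_norm (A *\<^sub>v v)) ` {v \<in> carrier_vec (dim_col A). l2_norm v \<le> 1})"
proof (rule bdd_aboveI2)
  fix v assume v: "v \<in> {v \<in> carrier_vec (dim_col A). l2_norm v \<le> 1}"
  have c: "cmod (v $ j) \<le> 1" if "j < dim_col A" for j
    using member_le_L2_set[of "{..<dim_vec v}" j "\<lambda>i. cmod (v $ i)"] v that
    by (auto simp: l2_norm_def)
  have "l2_norm (A *\<^sub>v v) \<le> (\<Sum>i<dim_row A. cmod ((A *\<^sub>v v) $ i))"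
    unfolding l2_norm_def dim_mult_mat_vec by (rule L2_set_le_sum) simp
  also have "\<dots> \<le> (\<Sum>i<dim_row A. \<Sum>j<dim_col A. cmod (A $$ (i, j)))"
  proof (rule sum_mono)
    fix i assume i: "i \<in> {..<dim_row A}"
    have "cmod ((A *\<^sub>v v) $ i) = cmod (\<Sum>j<dim_col A. A $$ (i,j) * v $ j)"
      using i v by (auto simp: scalar_prod_def lessThan_atLeast0)
    also have "\<dots> \<le> (\<Sum>j<dim_col A. cmod (A $$ (i, j)))"
      by (rule sum_norm_le) (use c in \<open>auto simp: norm_mult intro: mult_left_le\<close>)
    finally show "cmod ((A *\<^sub>v v) $ i) \<le> (\<Sum>j<dim_col A. cmod (A $$ (i, j)))" .
  qed
  finally show "l2_norm (A *\<^sub>v v) \<le> (\<Sum>i<dim_row A. \<Sum>j<dim_col A. cmod (A $$ (i, j)))" .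
qed

text \<open>\<open>tensor_mat N r a\<close> is \<open>\<Sum>\<^bsub>p,q<r\<^esub> a p q \<otimes> e\<^bsub>pq\<^esub>\<close> in \<open>M\<^sub>N \<otimes> M\<^sub>r\<close>.  For a subspace \<open>A\<close> of
  \<open>M\<^sub>N\<close>, every element of \<open>A \<otimes> M\<^sub>r\<close> has exactly one such expression with all \<open>a p q\<close> in \<open>A\<close>,
  and \<open>\<phi> \<otimes> id\<close> sends it to \<open>tensor_mat m r (\<lambda>p q. \<phi> (a p q))\<close>.\<close>

definition tensor_mat :: "nat \<Rightarrow> nat \<Rightarrow> (nat \<Rightarrow> nat \<Rightarrow> complex mat) \<Rightarrow> complex mat" where
  "tensor_mat N r a =
     (\<Oplus>\<^bsub>module_mat TYPE(complex) (N * r) (N * r)\<^esub> t \<in> {..<r} \<times> {..<r}.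
        kron (a (fst t) (snd t)) (mat_unit r (fst t) (snd t)))"

definition completely_positive ::
  "nat \<Rightarrow> (nat \<Rightarrow> nat) \<Rightarrow> nat \<Rightarrow> (complex mat \<Rightarrow> complex mat) \<Rightarrow> bool" where
  "completely_positive l n m \<phi> \<longleftrightarrow>
     (\<forall>r \<ge> 1. \<forall>a. (\<forall>p<r. \<forall>q<r. a p q \<in> block_alg l n) \<longrightarrow>
        positive_mat (tensor_mat (block_dim l n) r a) \<longrightarrow>
        positive_mat (tensor_mat m r (\<lambda>p q. \<phi> (a p q))))"

definition completely_contractive ::
  "nat \<Rightarrow> (nat \<Rightarrow> nat) \<Rightarrow> nat \<Rightarrow> (complex mat \<Rightarrow> complex mat) \<Rightarrow> bool" where
  "completely_contractive l n m \<phi> \<longleftrightarrow>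
     (\<forall>r \<ge> 1. \<forall>a. (\<forall>p<r. \<forall>q<r. a p q \<in> block_alg l n) \<longrightarrow>
        op_norm (tensor_mat m r (\<lambda>p q. \<phi> (a p q))) \<le> op_norm (tensor_mat (block_dim l n) r a))"

definition adjusted_choi ::
  "nat \<Rightarrow> (nat \<Rightarrow> nat) \<Rightarrow> nat \<Rightarrow> (complex mat \<Rightarrow> complex mat) \<Rightarrow> complex mat" where
  "adjusted_choi l n m \<phi> =
     (let V = module_mat TYPE(complex) (m * block_dim l n) (m * block_dim l n) in
      \<Oplus>\<^bsub>V\<^esub> k \<in> {..<l}. \<Oplus>\<^bsub>V\<^esub> i \<in> {..<n k}. \<Oplus>\<^bsub>V\<^esub> j \<in> {..<n k}.
        (1 / of_nat (n k)) \<cdot>\<^sub>m kron (\<phi> (block_unit l n i j k)) (block_unit l n i j k))"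

definition is_projection :: "complex mat \<Rightarrow> bool" where
  "is_projection P \<longleftrightarrow> mat_adjoint P = P \<and> P * P = P"

end

theory Submission
  imports Defs
begin

text \<open>Write \<open>N\<close> for the size of the block diagonal matrices and \<open>E\<^sub>s\<^sub>t\<close> for the matrix units of \<open>M\<^sub>N\<close>.  A matrix
lies in the block algebra iff its \<open>(s, t)\<close> entry vanishes whenever \<open>s\<close> and \<open>t\<close> belong to different
blocks (\<open>mem_block_alg_iff\<close>), so the units \<open>E\<^sub>s\<^sub>t\<close> with \<open>s\<close> and \<open>t\<close> in one block span it, and the
\<open>(s, t)\<close> block of the adjusted Choi matrix is \<open>\<phi> E\<^sub>s\<^sub>t\<close> divided by the size of that block,
and \<open>0\<close> for \<open>s\<close> and \<open>t\<close> in different blocks (\<open>adjusted_choi_entries\<close>).  Comparing entries, the Choi matrix is idempotent iff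
\[ \sum_u \varphi(E_{su})\,\varphi(E_{ut}) = n_k\,\varphi(E_{st}) \]
for all \<open>s, t\<close> in a common block, of number \<open>k\<close>, where \<open>u\<close> runs over the \<open>n k\<close> indices of that block
(\<open>choi_idempotent_iff\<close>).  It is self-adjoint because a positive map preserves adjoints
(\<open>map_adjoint\<close>, \<open>adjoint_choi\<close>).

For a multiplicative \<open>\<phi>\<close> all \<open>n k\<close> summands equal \<open>\<phi> E\<^sub>s\<^sub>t\<close>, which gives one direction.

Conversely, 2-positivity together with \<open>\<phi> 1 \<le> 1\<close> gives the Kadison-Schwarz inequality
\<open>\<phi> a (\<phi> a)\<^sup>* \<le> \<phi> (a a\<^sup>*)\<close> (\<open>Kadison_Schwarz\<close>).  For \<open>a = E\<^sub>s\<^sub>u\<close> it bounds each \<open>\<phi> E\<^sub>s\<^sub>u \<phi> E\<^sub>u\<^sub>s\<close> by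
\<open>\<phi> E\<^sub>s\<^sub>s\<close>.  For \<open>t = s\<close> the displayed identity says that the \<open>n k\<close> left-hand sides add up to \<open>n k\<close>
times this bound, so equality holds in every one of these inequalities (\<open>defect_unit_zero\<close>).  An
element for which Kadison-Schwarz is an equality lies in the multiplicative domain of \<open>\<phi>\<close>
(\<open>multiplicative_domain\<close>): the defect \<open>\<phi> (a b\<^sup>*) - \<phi> a (\<phi> b)\<^sup>*\<close> is a positive semidefinite form in
\<open>(a, b)\<close>, and a null vector of such a form is orthogonal to everything.  Hence every \<open>E\<^sub>s\<^sub>u\<close> in the
block algebra is in the multiplicative domain, and by linearity \<open>\<phi>\<close> is multiplicative.\<close>

section \<open>Entries of sums and products of matrices\<close>

lemma sum_lessThan_mult:
  fixes f :: "nat \<Rightarrow> 'a::comm_monoid_add"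
  shows "(\<Sum>I<a * b. f I) = (\<Sum>i<a. \<Sum>p<b. f (i * b + p))"
proof -
  have "sum f {i * b..<i * b + b} = (\<Sum>p<b. f (i * b + p))" for i
    using sum.shift_bounds_nat_ivl[of f 0 "i * b" b] by (simp add: add.commute lessThan_atLeast0)
  then show ?thesis
    by (simp flip: sum.nat_group)
qed

lemma mult_add_less:
  fixes i p a b :: nat
  assumes "i < a" "p < b"
  shows "i * b + p < a * b"
proof -
  have "i * b + p < Suc i * b" using assms by simp
  also have "\<dots> \<le> a * b" using assms by (intro mult_le_mono1) simp
  finally show ?thesis .
qed

lemma finsum_mat_closed:
  assumes "\<And>x. x \<in> X \<Longrightarrow> f x \<in> carrier_mat nr nc"
  shows "(\<Oplus>\<^bsub>module_mat TYPE('a::comm_ring_1) nr nc\<^esub> x \<in> X. f x) \<in> carrier_mat nr nc"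
proof -
  interpret abelian_group "module_mat TYPE('a) nr nc" by (rule abelian_group_mat)
  show ?thesis using finsum_closed[of f X] assms by (auto simp: module_mat_simps)
qed

lemma index_finsum_mat:
  assumes "finite X" "\<And>x. x \<in> X \<Longrightarrow> f x \<in> carrier_mat nr nc" "i < nr" "j < nc"
  shows "(\<Oplus>\<^bsub>module_mat TYPE('a::comm_ring_1) nr nc\<^esub> x \<in> X. f x) $$ (i, j) = (\<Sum>x\<in>X. f x $$ (i, j))"
  using assms
proof (induction X)
  case empty
  interpret abelian_group "module_mat TYPE('a) nr nc" by (rule abelian_group_mat)
  show ?case using empty by (simp add: module_mat_simps)
next
  case (insert x X)
  interpret abelian_group "module_mat TYPE('a) nr nc" by (rule abelian_group_mat)
  have "(\<Oplus>\<^bsub>module_mat TYPE('a) nr nc\<^esub> y \<in> insert x X. f y)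
      = f x + (\<Oplus>\<^bsub>module_mat TYPE('a) nr nc\<^esub> y \<in> X. f y)"
    using insert by (subst finsum_insert) (auto simp: module_mat_simps)
  then show ?case using insert finsum_mat_closed[of X f nr nc] by auto
qed

lemma index_mult_mat_sum:
  assumes "A \<in> carrier_mat a c" "B \<in> carrier_mat c d" "i < a" "j < d"
  shows "(A * B) $$ (i, j) = (\<Sum>u<c. A $$ (i, u) * B $$ (u, j))"
  using assms by (auto simp: scalar_prod_def lessThan_atLeast0)

section \<open>Adjoints and quadratic forms\<close>

lemma adjoint_carrier: "A \<in> carrier_mat a c \<Longrightarrow> mat_adjoint A \<in> carrier_mat c a"
  by (auto simp: mat_adjoint_def)

lemma index_adjoint:
  fixes A :: "complex mat"
  assumes "A \<in> carrier_mat a c" "i < c" "j < a"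
  shows "mat_adjoint A $$ (i, j) = cnj (A $$ (j, i))"
  using assms by (auto simp: mat_adjoint_def mat_of_rows_def)

lemma adjoint_adjoint:
  fixes A :: "complex mat"
  assumes A: "A \<in> carrier_mat a c"
  shows "mat_adjoint (mat_adjoint A) = A"
  using A adjoint_carrier[OF A] adjoint_carrier[OF adjoint_carrier[OF A]]
  by (intro eq_matI) (auto simp: index_adjoint[OF A] index_adjoint[OF adjoint_carrier[OF A]])

lemma adjoint_zero: "mat_adjoint (0\<^sub>m a a :: complex mat) = 0\<^sub>m a a"
proof (rule eq_matI)
  fix i j assume "i < dim_row (0\<^sub>m a a :: complex mat)" "j < dim_col (0\<^sub>m a a :: complex mat)"
  then show "mat_adjoint (0\<^sub>m a a) $$ (i, j) = (0\<^sub>m a a :: complex mat) $$ (i, j)"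
    by (subst index_adjoint[of _ a a]) auto
qed (auto simp: mat_adjoint_def)

lemma adjoint_add_smult:
  fixes x y :: "complex mat"
  assumes "x \<in> carrier_mat k k" "y \<in> carrier_mat k k"
  shows "mat_adjoint (x + c \<cdot>\<^sub>m y) = mat_adjoint x + cnj c \<cdot>\<^sub>m mat_adjoint y"
proof (rule eq_matI)
  have *: "x + c \<cdot>\<^sub>m y \<in> carrier_mat k k" using assms by auto
  fix i j assume "i < dim_row (mat_adjoint x + cnj c \<cdot>\<^sub>m mat_adjoint y)"
    "j < dim_col (mat_adjoint x + cnj c \<cdot>\<^sub>m mat_adjoint y)"
  then have "i < k" "j < k" using adjoint_carrier[OF assms(2)] by auto
  then show "mat_adjoint (x + c \<cdot>\<^sub>m y) $$ (i, j) = (mat_adjoint x + cnj c \<cdot>\<^sub>m mat_adjoint y) $$ (i, j)"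
    using assms adjoint_carrier[OF assms(1)] adjoint_carrier[OF assms(2)]
    by (simp add: index_adjoint[OF *] index_adjoint[OF assms(1)] index_adjoint[OF assms(2)])
qed (use assms in \<open>auto simp: mat_adjoint_def\<close>)

lemma cscalar_mult_mat_vec:
  assumes "A \<in> carrier_mat a c" "u \<in> carrier_vec c" "v \<in> carrier_vec a"
  shows "(A *\<^sub>v u) \<bullet>c v = (\<Sum>i<a. \<Sum>j<c. A $$ (i, j) * u $ j * cnj (v $ i))"
  using assms
  by (auto simp: scalar_prod_def lessThan_atLeast0 sum_distrib_right intro!: sum.cong)

lemma cscalar_adjoint:
  fixes A :: "complex mat"
  assumes "A \<in> carrier_mat a c" "u \<in> carrier_vec c" "v \<in> carrier_vec a"
  shows "(A *\<^sub>v u) \<bullet>c v = u \<bullet>c (mat_adjoint A *\<^sub>v v)"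
proof -
  have "u \<bullet>c (mat_adjoint A *\<^sub>v v) = (\<Sum>j<c. \<Sum>i<a. A $$ (i, j) * u $ j * cnj (v $ i))"
    using assms adjoint_carrier[OF assms(1)]
    by (auto simp: scalar_prod_def lessThan_atLeast0 sum_distrib_left cnj_sum
        index_adjoint[OF assms(1)] intro!: sum.cong)
  also have "\<dots> = (\<Sum>i<a. \<Sum>j<c. A $$ (i, j) * u $ j * cnj (v $ i))" by (rule sum.swap)
  finally show ?thesis using cscalar_mult_mat_vec[OF assms] by simp
qed

lemma cscalar_add_smult_mat:
  fixes X Y :: "complex mat"
  assumes "X \<in> carrier_mat a a" "Y \<in> carrier_mat a a" "v \<in> carrier_vec a"
  shows "((X + c \<cdot>\<^sub>m Y) *\<^sub>v v) \<bullet>c v = (X *\<^sub>v v) \<bullet>c v + c * ((Y *\<^sub>v v) \<bullet>c v)"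
proof -
  have XY: "X + c \<cdot>\<^sub>m Y \<in> carrier_mat a a" using assms by auto
  show ?thesis
    unfolding cscalar_mult_mat_vec[OF XY assms(3,3)] cscalar_mult_mat_vec[OF assms(1,3,3)]
      cscalar_mult_mat_vec[OF assms(2,3,3)]
    using assms by (simp add: sum.distrib sum_distrib_left algebra_simps)
qed

lemma cscalar_mat_unit_vec:
  assumes "A \<in> carrier_mat a a" "i < a" "j < a"
  shows "(A *\<^sub>v unit_vec a j) \<bullet>c unit_vec a i = (A $$ (i, j) :: complex)"
proof -
  have "(\<Sum>i'<a. \<Sum>j'<a. A $$ (i', j') * unit_vec a j $ j' * cnj (unit_vec a i $ i'))
      = (\<Sum>i'<a. \<Sum>j'<a. if j' = j then (if i' = i then A $$ (i', j') else 0) else 0)"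
    using assms by (intro sum.cong) auto
  also have "\<dots> = A $$ (i, j)" using assms by (simp add: sum.delta)
  finally show ?thesis
    using cscalar_mult_mat_vec[OF assms(1), of "unit_vec a j" "unit_vec a i"] by simp
qed

text \<open>Polarization over the complex numbers: testing on \<open>e\<^sub>j + c e\<^sub>i\<close> for \<open>c = 1\<close> and \<open>c = \<i>\<close> separates the
two off-diagonal entries.\<close>

lemma eq_mat_if_quadratic_forms_eq:
  fixes A B :: "complex mat"
  assumes A: "A \<in> carrier_mat a a" and B: "B \<in> carrier_mat a a"
    and eq: "\<And>v. v \<in> carrier_vec a \<Longrightarrow> (A *\<^sub>v v) \<bullet>c v = (B *\<^sub>v v) \<bullet>c v"
  shows "A = B"
proof (rule eq_matI)
  define D where "D = A - B"
  have D: "D \<in> carrier_mat a a" unfolding D_def using B by (rule minus_carrier_mat)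
  have D0: "(D *\<^sub>v v) \<bullet>c v = 0" if v: "v \<in> carrier_vec a" for v
    using eq[OF v] A B v unfolding D_def
    by (simp add: minus_mult_distrib_mat_vec minus_scalar_prod_distrib[of _ a])
  fix i j assume "i < dim_row B" "j < dim_col B"
  then have ij: "i < a" "j < a" using B by auto
  define e where "e = (unit_vec a :: nat \<Rightarrow> complex vec)"
  have e: "e i \<in> carrier_vec a" for i by (simp add: e_def)
  have "(D *\<^sub>v (e j + c \<cdot>\<^sub>v e i)) \<bullet>c (e j + c \<cdot>\<^sub>v e i)
      = (D *\<^sub>v e j) \<bullet>c e j + cnj c * ((D *\<^sub>v e j) \<bullet>c e i) + c * ((D *\<^sub>v e i) \<bullet>c e j)
        + c * cnj c * ((D *\<^sub>v e i) \<bullet>c e i)" for c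
    using D e[of i] e[of j]
    by (simp add: mult_add_distrib_mat_vec[of _ a a] mult_mat_vec conjugate_add_vec[of _ a] conjugate_smult_vec
       add_scalar_prod_distrib[of _ a] scalar_prod_add_distrib[of _ a] algebra_simps)
  then have "0 = cnj c * ((D *\<^sub>v e j) \<bullet>c e i) + c * ((D *\<^sub>v e i) \<bullet>c e j)" for c
    using D0 e by simp
  from this[of 1] this[of \<i>] have "(D *\<^sub>v e j) \<bullet>c e i = 0"
    by (simp add: complex_eq_iff)
  then show "A $$ (i, j) = B $$ (i, j)"
    using cscalar_mat_unit_vec[OF D ij] A B ij by (simp add: e_def D_def)
qed (use A B in auto)

section \<open>Positivity in matrix amplifications\<close>

lemma index_kron:
  assumes "A \<in> carrier_mat a a'" "B \<in> carrier_mat b b'" "i < a" "j < a'" "p < b" "q < b'"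
  shows "kron A B $$ (i * b + p, j * b' + q) = A $$ (i, j) * B $$ (p, q)"
  using assms mult_add_less[of i a p b] mult_add_less[of j a' q b'] by (auto simp: kron_def)

lemma kron_carrier:
  assumes "A \<in> carrier_mat a a'" "B \<in> carrier_mat b b'"
  shows "kron A B \<in> carrier_mat (a * b) (a' * b')"
  using assms by (auto simp: kron_def)

lemma tensor_mat_carrier:
  assumes "\<And>p q. p < r \<Longrightarrow> q < r \<Longrightarrow> a p q \<in> carrier_mat N N"
  shows "tensor_mat N r a \<in> carrier_mat (N * r) (N * r)"
  unfolding tensor_mat_def using assms
  by (intro finsum_mat_closed kron_carrier) (auto simp: mat_unit_def)

lemma index_tensor_mat:
  assumes a: "\<And>p q. p < r \<Longrightarrow> q < r \<Longrightarrow> a p q \<in> carrier_mat N N"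
    and ij: "i < N" "j < N" "p < r" "q < r"
  shows "tensor_mat N r a $$ (i * r + p, j * r + q) = a p q $$ (i, j)"
proof -
  have "tensor_mat N r a $$ (i * r + p, j * r + q)
      = (\<Sum>t\<in>{..<r} \<times> {..<r}. kron (a (fst t) (snd t)) (mat_unit r (fst t) (snd t)) $$ (i * r + p, j * r + q))"
    unfolding tensor_mat_def
    by (rule index_finsum_mat) (use a ij in \<open>auto simp: mat_unit_def intro!: kron_carrier mult_add_less\<close>)
  also have "\<dots> = (\<Sum>t\<in>{..<r} \<times> {..<r}. if t = (p, q) then a p q $$ (i, j) else 0)"
  proof (rule sum.cong[OF refl])
    fix t assume t: "t \<in> {..<r} \<times> {..<r}"
    have "kron (a (fst t) (snd t)) (mat_unit r (fst t) (snd t)) $$ (i * r + p, j * r + q)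
       = a (fst t) (snd t) $$ (i, j) * mat_unit r (fst t) (snd t) $$ (p, q)"
      using t ij by (intro index_kron[where a = N and a' = N]) (auto simp: mat_unit_def a)
    then show "kron (a (fst t) (snd t)) (mat_unit r (fst t) (snd t)) $$ (i * r + p, j * r + q)
       = (if t = (p, q) then a p q $$ (i, j) else 0)"
      using t ij by (auto simp: mat_unit_def)
  qed
  also have "\<dots> = a p q $$ (i, j)" using ij by (simp add: sum.delta)
  finally show ?thesis .
qed

lemma cscalar_tensor_mat:
  assumes a: "\<And>p q. p < r \<Longrightarrow> q < r \<Longrightarrow> a p q \<in> carrier_mat N N"
    and v: "v \<in> carrier_vec (N * r)"
  defines "x \<equiv> \<lambda>p. vec N (\<lambda>i. v $ (i * r + p))"
  shows "(tensor_mat N r a *\<^sub>v v) \<bullet>c v = (\<Sum>p<r. \<Sum>q<r. (a p q *\<^sub>v x q) \<bullet>c x p)"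
proof -
  have T: "tensor_mat N r a \<in> carrier_mat (N * r) (N * r)" by (rule tensor_mat_carrier[OF a])
  have "(tensor_mat N r a *\<^sub>v v) \<bullet>c v
     = (\<Sum>i<N. \<Sum>p<r. \<Sum>j<N. \<Sum>q<r. a p q $$ (i, j) * x q $ j * cnj (x p $ i))"
    unfolding cscalar_mult_mat_vec[OF T v v] sum_lessThan_mult
    by (intro sum.cong refl) (simp add: index_tensor_mat a x_def)
  also have "\<dots> = (\<Sum>p<r. \<Sum>i<N. \<Sum>q<r. \<Sum>j<N. a p q $$ (i, j) * x q $ j * cnj (x p $ i))"
    by (rule trans[OF sum.swap]) (rule sum.cong[OF refl], rule sum.cong[OF refl], rule sum.swap)
  also have "\<dots> = (\<Sum>p<r. \<Sum>q<r. \<Sum>i<N. \<Sum>j<N. a p q $$ (i, j) * x q $ j * cnj (x p $ i))"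
    by (rule sum.cong[OF refl], rule sum.swap)
  also have "\<dots> = (\<Sum>p<r. \<Sum>q<r. (a p q *\<^sub>v x q) \<bullet>c x p)"
    by (intro sum.cong refl cscalar_mult_mat_vec[symmetric]) (auto simp: a x_def)
  finally show ?thesis .
qed

text \<open>A vector of \<open>\<complex>\<^sup>N \<otimes> \<complex>\<^sup>r\<close> is a family of \<open>r\<close> vectors of \<open>\<complex>\<^sup>N\<close>.  In this form complete positivity can be
used without any index arithmetic.\<close>

lemma positive_tensor_mat_iff:
  assumes a: "\<And>p q. p < r \<Longrightarrow> q < r \<Longrightarrow> a p q \<in> carrier_mat N N"
  shows "positive_mat (tensor_mat N r a) \<longleftrightarrow>
    (\<forall>x. (\<forall>p<r. x p \<in> carrier_vec N) \<longrightarrow> 0 \<le> (\<Sum>p<r. \<Sum>q<r. (a p q *\<^sub>v x q) \<bullet>c x p))"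
proof
  have T: "tensor_mat N r a \<in> carrier_mat (N * r) (N * r)" by (rule tensor_mat_carrier[OF a])
  show "positive_mat (tensor_mat N r a)" if *: "\<forall>x. (\<forall>p<r. x p \<in> carrier_vec N) \<longrightarrow>
    0 \<le> (\<Sum>p<r. \<Sum>q<r. (a p q *\<^sub>v x q) \<bullet>c x p)"
    unfolding positive_mat_def using T by (auto simp: cscalar_tensor_mat a intro!: *[rule_format])
  assume pos: "positive_mat (tensor_mat N r a)"
  show "\<forall>x. (\<forall>p<r. x p \<in> carrier_vec N) \<longrightarrow> 0 \<le> (\<Sum>p<r. \<Sum>q<r. (a p q *\<^sub>v x q) \<bullet>c x p)"
  proof (intro allI impI)
    fix x :: "nat \<Rightarrow> complex vec" assume x: "\<forall>p<r. x p \<in> carrier_vec N"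
    define v where "v = vec (N * r) (\<lambda>I. x (I mod r) $ (I div r))"
    have "0 \<le> (tensor_mat N r a *\<^sub>v v) \<bullet>c v" using pos T unfolding positive_mat_def by (simp add: v_def)
    also have "\<dots> = (\<Sum>p<r. \<Sum>q<r. (a p q *\<^sub>v vec N (\<lambda>i. v $ (i * r + q))) \<bullet>c vec N (\<lambda>i. v $ (i * r + p)))"
      by (rule cscalar_tensor_mat) (auto simp: a v_def)
    also have "\<dots> = (\<Sum>p<r. \<Sum>q<r. (a p q *\<^sub>v x q) \<bullet>c x p)"
    proof -
      have "vec N (\<lambda>i. v $ (i * r + p)) = x p" if "p < r" for p
        using x that by (intro eq_vecI) (auto simp: v_def mult_add_less)
      then show ?thesis by simp
    qed
    finally show "0 \<le> (\<Sum>p<r. \<Sum>q<r. (a p q *\<^sub>v x q) \<bullet>c x p)" .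
  qed
qed

lemma tensor_mat_1:
  assumes "x \<in> carrier_mat N N"
  shows "tensor_mat N 1 (\<lambda>p q. x) = x"
proof (rule eq_matI)
  fix i j assume "i < dim_row x" "j < dim_col x"
  then show "tensor_mat N 1 (\<lambda>p q. x) $$ (i, j) = x $$ (i, j)"
    using index_tensor_mat[of 1 "\<lambda>p q. x" N i j 0 0] assms by simp
qed (use tensor_mat_carrier[of 1 "\<lambda>p q. x" N] assms in auto)

section \<open>Euclidean and operator norm\<close>

lemma norm_cscalar_le:
  assumes "u \<in> carrier_vec a" "v \<in> carrier_vec a"
  shows "cmod (u \<bullet>c v) \<le> l2_norm u * l2_norm v"
proof -
  have "u \<bullet>c v = (\<Sum>i<a. u $ i * cnj (v $ i))"
    using assms by (auto simp: scalar_prod_def lessThan_atLeast0)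
  then have "cmod (u \<bullet>c v) \<le> (\<Sum>i<a. \<bar>cmod (u $ i)\<bar> * \<bar>cmod (v $ i)\<bar>)"
    by (auto intro!: sum_norm_le simp: norm_mult)
  also have "\<dots> \<le> l2_norm u * l2_norm v"
    unfolding l2_norm_def
    using L2_set_mult_ineq[of "\<lambda>i. cmod (u $ i)" "\<lambda>i. cmod (v $ i)" "{..<a}"] assms by auto
  finally show ?thesis .
qed

lemma cscalar_self: "v \<bullet>c v = of_real ((l2_norm v)\<^sup>2)"
proof -
  have "v \<bullet>c v = (\<Sum>i<dim_vec v. of_real ((cmod (v $ i))\<^sup>2))"
    by (auto simp: scalar_prod_def lessThan_atLeast0 simp flip: complex_norm_square intro!: sum.cong)
  then show ?thesis by (simp add: l2_norm_def L2_set_def sum_nonneg)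
qed

lemma l2_norm_smult: "l2_norm (c \<cdot>\<^sub>v v) = cmod c * l2_norm v"
proof -
  have "l2_norm (c \<cdot>\<^sub>v v) = L2_set (\<lambda>i. cmod c * cmod (v $ i)) {..<dim_vec v}"
    unfolding l2_norm_def by (rule L2_set_cong) (auto simp: norm_mult)
  then show ?thesis by (simp add: l2_norm_def L2_set_right_distrib)
qed

lemma op_norm_one_le: "op_norm (1\<^sub>m a) \<le> 1"
  unfolding op_norm_def
proof (rule cSUP_least)
  show "{v \<in> carrier_vec (dim_col (1\<^sub>m a)). l2_norm v \<le> 1} \<noteq> {}"
    by (auto intro!: exI[of _ "0\<^sub>v a"] simp: l2_norm_def L2_set_def)
qed auto

lemma l2_norm_mult_mat_vec_le:
  assumes A: "A \<in> carrier_mat a c" and v: "v \<in> carrier_vec c"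
  shows "l2_norm (A *\<^sub>v v) \<le> op_norm A * l2_norm v"
proof (cases "l2_norm v = 0")
  case True
  then have "v = 0\<^sub>v c" using cscalar_self[of v] v by simp
  then show ?thesis using A by (auto simp: l2_norm_def L2_set_def scalar_prod_def)
next
  case False
  then have pos: "l2_norm v > 0" unfolding l2_norm_def using L2_set_nonneg by (smt (verit))
  define u where "u = of_real (1 / l2_norm v) \<cdot>\<^sub>v v"
  have "l2_norm (A *\<^sub>v u) \<le> op_norm A"
    unfolding op_norm_def
    by (rule cSUP_upper[OF _ op_norm_bdd_above]) (use A v pos in \<open>auto simp: u_def l2_norm_smult norm_divide\<close>)
  also have "A *\<^sub>v u = of_real (1 / l2_norm v) \<cdot>\<^sub>v (A *\<^sub>v v)"
    unfolding u_def using A v by (rule mult_mat_vec)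
  finally show ?thesis using pos by (simp add: l2_norm_smult norm_divide field_simps)
qed

section \<open>The block algebra in the coordinates of the ambient matrix algebra\<close>

text \<open>The direct sum is described through the partition of the row indices into consecutive blocks; block
\<open>k\<close> starts at \<open>block_dim k n\<close>.\<close>

definition block_of :: "(nat \<Rightarrow> nat) \<Rightarrow> nat \<Rightarrow> nat" where
  "block_of n s = (LEAST k. s < block_dim (Suc k) n)"

lemma block_dim_Suc: "block_dim (Suc k) n = block_dim k n + n k"
  by (simp add: block_dim_def)

lemma block_dim_mono: "k \<le> k' \<Longrightarrow> block_dim k n \<le> block_dim k' n"
  unfolding block_dim_def by (rule sum_mono2) auto

lemma block_of_offset:
  assumes "i < n k"
  shows "block_of n (block_dim k n + i) = k"
  unfolding block_of_def
proof (rule Least_equality)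
  fix y assume y: "block_dim k n + i < block_dim (Suc y) n"
  show "k \<le> y"
  proof (rule ccontr)
    assume "\<not> k \<le> y"
    then show False using y block_dim_mono[of "Suc y" k n] by simp
  qed
qed (use assms in \<open>simp add: block_dim_Suc\<close>)

lemma block_dim_cases:
  assumes "s < block_dim l n"
  obtains k i where "k < l" "i < n k" "s = block_dim k n + i"
  using assms
proof (induction l arbitrary: thesis)
  case 0
  then show ?case by (simp add: block_dim_def)
next
  case (Suc l)
  show ?case
  proof (cases "s < block_dim l n")
    case True
    then show ?thesis using Suc.IH Suc.prems(1) by (metis less_SucI)
  next
    case False
    then show ?thesis
      using Suc.prems(1)[of l "s - block_dim l n"] Suc.prems(2) by (simp add: block_dim_Suc)
  qed
qed

lemma block_of_less: "s < block_dim l n \<Longrightarrow> block_of n s < l"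
  by (metis block_dim_cases block_of_offset)

lemma offset_less: "k < l \<Longrightarrow> i < n k \<Longrightarrow> block_dim k n + i < block_dim l n"
  using block_dim_mono[of "Suc k" l n] by (simp add: block_dim_Suc)

lemma offset_eq_iff:
  assumes "i < n k" "i' < n k'"
  shows "block_dim k n + i = block_dim k' n + i' \<longleftrightarrow> k = k' \<and> i = i'"
  using assms by (metis add_left_cancel block_of_offset)

lemma block_eq_image:
  assumes "k < l"
  shows "{u. u < block_dim l n \<and> block_of n u = k} = (\<lambda>i. block_dim k n + i) ` {..<n k}"
proof (intro equalityI subsetI)
  fix u assume u: "u \<in> {u. u < block_dim l n \<and> block_of n u = k}"
  then obtain k' i where "i < n k'" "u = block_dim k' n + i" by (auto elim: block_dim_cases)
  then show "u \<in> (\<lambda>i. block_dim k n + i) ` {..<n k}" using u by (auto simp: block_of_offset)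
qed (use assms in \<open>auto simp: block_of_offset offset_less\<close>)

lemma card_block:
  assumes "k < l"
  shows "card {u. u < block_dim l n \<and> block_of n u = k} = n k"
  unfolding block_eq_image[OF assms] by (simp add: card_image)

lemma block_sum_entries:
  assumes "\<And>k. k < l \<Longrightarrow> a k \<in> carrier_mat (n k) (n k)"
  shows "block_sum l a \<in> carrier_mat (block_dim l n) (block_dim l n)"
    and "k < l \<Longrightarrow> k' < l \<Longrightarrow> i < n k \<Longrightarrow> j < n k' \<Longrightarrow>
      block_sum l a $$ (block_dim k n + i, block_dim k' n + j) = (if k = k' then a k $$ (i, j) else 0)"
proof -
  have "block_sum l a \<in> carrier_mat (block_dim l n) (block_dim l n) \<and>
    (\<forall>k<l. \<forall>k'<l. \<forall>i<n k. \<forall>j<n k'. block_sum l a $$ (block_dim k n + i, block_dim k' n + j)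
      = (if k = k' then a k $$ (i, j) else 0))"
    using assms
  proof (induction l)
    case 0
    then show ?case by (simp add: block_sum_def block_dim_def)
  next
    case (Suc l)
    define B where "B = block_sum l a"
    have B: "B \<in> carrier_mat (block_dim l n) (block_dim l n)"
      and entry: "\<And>k k' i j. k < l \<Longrightarrow> k' < l \<Longrightarrow> i < n k \<Longrightarrow> j < n k' \<Longrightarrow>
        B $$ (block_dim k n + i, block_dim k' n + j) = (if k = k' then a k $$ (i, j) else 0)"
      using Suc by (auto simp: B_def)
    have al: "a l \<in> carrier_mat (n l) (n l)" using Suc.prems by simp
    have eq: "block_sum (Suc l) a
      = four_block_mat B (0\<^sub>m (block_dim l n) (n l)) (0\<^sub>m (n l) (block_dim l n)) (a l)"
      using B al by (simp add: block_sum_def B_def diag_block_mat_last Let_def)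
    have "block_sum (Suc l) a $$ (block_dim k n + i, block_dim k' n + j)
        = (if k = k' then a k $$ (i, j) else 0)"
      if "k < Suc l" "k' < Suc l" "i < n k" "j < n k'" for k k' i j
      using that offset_less[of k "Suc l" i n] offset_less[of k' "Suc l" j n]
        offset_less[of k l i n] offset_less[of k' l j n] B al
      unfolding eq by (auto simp: entry less_Suc_eq block_dim_Suc)
    then show ?case using B al unfolding eq by (auto simp: block_dim_Suc)
  qed
  then show "block_sum l a \<in> carrier_mat (block_dim l n) (block_dim l n)"
    "k < l \<Longrightarrow> k' < l \<Longrightarrow> i < n k \<Longrightarrow> j < n k' \<Longrightarrow>
      block_sum l a $$ (block_dim k n + i, block_dim k' n + j) = (if k = k' then a k $$ (i, j) else 0)"
    by auto
qed

lemma mem_block_alg_iff: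
  "x \<in> block_alg l n \<longleftrightarrow> x \<in> carrier_mat (block_dim l n) (block_dim l n) \<and>
    (\<forall>s<block_dim l n. \<forall>t<block_dim l n. block_of n s \<noteq> block_of n t \<longrightarrow> x $$ (s, t) = 0)"
    (is "_ \<longleftrightarrow> ?R")
proof
  assume "x \<in> block_alg l n"
  then obtain a where a: "\<And>k. k < l \<Longrightarrow> a k \<in> carrier_mat (n k) (n k)" and x: "x = block_sum l a"
    by (auto simp: block_alg_def)
  show ?R
    unfolding x using block_sum_entries[where n = n and a = a and l = l, OF a]
    by (auto elim!: block_dim_cases simp: block_of_offset)
next
  assume x: ?R
  define a where "a k = mat (n k) (n k) (\<lambda>(i, j). x $$ (block_dim k n + i, block_dim k n + j))" for k
  have a: "a k \<in> carrier_mat (n k) (n k)" for k by (simp add: a_def)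
  have "x = block_sum l a"
  proof (rule eq_matI)
    fix s t assume "s < dim_row (block_sum l a)" "t < dim_col (block_sum l a)"
    then have "s < block_dim l n" "t < block_dim l n"
      using block_sum_entries(1)[of l a n, OF a] by auto
    then show "x $$ (s, t) = block_sum l a $$ (s, t)"
      using x block_sum_entries(2)[of l a n, OF a]
      by (elim block_dim_cases) (auto simp: a_def block_of_offset offset_less)
  qed (use x block_sum_entries(1)[of l a n, OF a] in auto)
  then show "x \<in> block_alg l n" using a by (auto simp: block_alg_def)
qed

lemma mat_unit_carrier: "mat_unit N s t \<in> carrier_mat N N"
  by (simp add: mat_unit_def)

lemma index_mat_unit:
  "p < N \<Longrightarrow> q < N \<Longrightarrow> mat_unit N s t $$ (p, q) = (if p = s \<and> q = t then 1 else 0)"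
  by (simp add: mat_unit_def)

lemma mat_unit_mult:
  assumes "u < N"
  shows "mat_unit N s u * mat_unit N u t = mat_unit N s t"
proof (rule eq_matI)
  fix p q assume "p < dim_row (mat_unit N s t)" "q < dim_col (mat_unit N s t)"
  then have pq: "p < N" "q < N" by (auto simp: mat_unit_def)
  have "(mat_unit N s u * mat_unit N u t) $$ (p, q)
      = (\<Sum>w<N. if w = u then (if p = s \<and> q = t then 1 else 0) else 0)"
    unfolding index_mult_mat_sum[OF mat_unit_carrier mat_unit_carrier pq]
    using pq by (intro sum.cong) (auto simp: index_mat_unit)
  then show "(mat_unit N s u * mat_unit N u t) $$ (p, q) = mat_unit N s t $$ (p, q)"
    using assms pq by (simp add: index_mat_unit)
qed (auto simp: mat_unit_def)

lemma adjoint_mat_unit: "mat_adjoint (mat_unit N s t) = mat_unit N t s"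
proof (rule eq_matI)
  fix p q assume "p < dim_row (mat_unit N t s)" "q < dim_col (mat_unit N t s)"
  then show "mat_adjoint (mat_unit N s t) $$ (p, q) = mat_unit N t s $$ (p, q)"
    by (subst index_adjoint[OF mat_unit_carrier]) (auto simp: mat_unit_def)
qed (auto simp: mat_unit_def mat_adjoint_def)

lemma block_unit_eq_mat_unit:
  assumes "k < l" "i < n k" "j < n k"
  shows "block_unit l n i j k = mat_unit (block_dim l n) (block_dim k n + i) (block_dim k n + j)"
proof -
  define a where "a = (\<lambda>k'. if k' = k then mat_unit (n k) i j else 0\<^sub>m (n k') (n k'))"
  have a: "a k' \<in> carrier_mat (n k') (n k')" for k' by (simp add: a_def mat_unit_carrier)
  note B = block_sum_entries[of l a n, OF a]
  have entry: "a k' $$ (p, q) = (if k' = k \<and> p = i \<and> q = j then 1 else 0)"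
    if "p < n k'" "q < n k'" for k' p q
    using that by (auto simp: a_def index_mat_unit)
  have "block_sum l a = mat_unit (block_dim l n) (block_dim k n + i) (block_dim k n + j)"
  proof (rule eq_matI)
    fix s t assume "s < dim_row (mat_unit (block_dim l n) (block_dim k n + i) (block_dim k n + j))"
      "t < dim_col (mat_unit (block_dim l n) (block_dim k n + i) (block_dim k n + j))"
    then have "s < block_dim l n" "t < block_dim l n" by (auto simp: mat_unit_def)
    then show "block_sum l a $$ (s, t)
      = mat_unit (block_dim l n) (block_dim k n + i) (block_dim k n + j) $$ (s, t)"
      using assms by (elim block_dim_cases)
        (auto simp: B offset_less index_mat_unit offset_eq_iff entry)
  qed (use B(1) in \<open>auto simp: mat_unit_def\<close>)
  then show ?thesis by (simp add: block_unit_def a_def)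
qed

lemma block_alg_carrier: "x \<in> block_alg l n \<Longrightarrow> x \<in> carrier_mat (block_dim l n) (block_dim l n)"
  by (simp add: mem_block_alg_iff)

lemma block_alg_zero: "0\<^sub>m (block_dim l n) (block_dim l n) \<in> block_alg l n"
  by (simp add: mem_block_alg_iff)

lemma block_alg_one: "1\<^sub>m (block_dim l n) \<in> block_alg l n"
  by (auto simp: mem_block_alg_iff)

lemma block_alg_add: "x \<in> block_alg l n \<Longrightarrow> y \<in> block_alg l n \<Longrightarrow> x + y \<in> block_alg l n"
  by (auto simp: mem_block_alg_iff)

lemma block_alg_smult: "x \<in> block_alg l n \<Longrightarrow> c \<cdot>\<^sub>m x \<in> block_alg l n"
  by (auto simp: mem_block_alg_iff)

lemma block_alg_adjoint: "x \<in> block_alg l n \<Longrightarrow> mat_adjoint x \<in> block_alg l n"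
  by (auto simp: mem_block_alg_iff adjoint_carrier index_adjoint)

lemma block_alg_mult:
  assumes "x \<in> block_alg l n" "y \<in> block_alg l n"
  shows "x * y \<in> block_alg l n"
proof -
  have x: "x \<in> carrier_mat (block_dim l n) (block_dim l n)"
    and y: "y \<in> carrier_mat (block_dim l n) (block_dim l n)"
    using assms by (auto intro: block_alg_carrier)
  show ?thesis
    using assms mult_carrier_mat[OF x y] unfolding mem_block_alg_iff
    by (auto simp del: index_mult_mat simp: index_mult_mat_sum[OF x y] intro!: sum.neutral)
      (metis mult_zero_left mult_zero_right)
qed

lemma block_alg_mat_unit:
  assumes "s < block_dim l n" "t < block_dim l n" "block_of n s = block_of n t"
  shows "mat_unit (block_dim l n) s t \<in> block_alg l n"
  using assms by (auto simp: mem_block_alg_iff mat_unit_carrier index_mat_unit)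

text \<open>The matrix units inside the blocks span the block algebra: a matrix is built up by switching on its
entries one position at a time.  The entries at positions outside the blocks are zero, so
switching them on changes nothing.\<close>

lemma block_alg_induct [consumes 1, case_names zero add]:
  assumes x: "x \<in> block_alg l n"
    and zero: "P (0\<^sub>m (block_dim l n) (block_dim l n))"
    and add: "\<And>y c s t. y \<in> block_alg l n \<Longrightarrow> P y \<Longrightarrow> s < block_dim l n \<Longrightarrow> t < block_dim l n \<Longrightarrow>
      block_of n s = block_of n t \<Longrightarrow> P (y + c \<cdot>\<^sub>m mat_unit (block_dim l n) s t)"
  shows "P x"
proof -
  define N where "N = block_dim l n"
  define y where "y X = mat N N (\<lambda>p. if p \<in> X then x $$ p else 0)" for X
  have xc: "x \<in> carrier_mat N N" using x by (simp add: N_def block_alg_carrier)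
  have x0: "x $$ (s, t) = 0" if "s < N" "t < N" "block_of n s \<noteq> block_of n t" for s t
    using x that by (simp add: N_def mem_block_alg_iff)
  have yA: "y X \<in> block_alg l n" for X
    unfolding mem_block_alg_iff using x0 by (auto simp: y_def N_def[symmetric])
  have "P (y X)" if "finite X" "X \<subseteq> {..<N} \<times> {..<N}" for X
    using that
  proof (induction X)
    case empty
    have "y {} = 0\<^sub>m N N" by (auto simp: y_def)
    then show ?case using zero by (simp add: N_def)
  next
    case (insert p X)
    obtain s t where p: "p = (s, t)" by (cases p)
    have st: "s < N" "t < N" using insert p by auto
    show ?case
    proof (cases "block_of n s = block_of n t")
      case True
      have "y (insert p X) = y X + x $$ (s, t) \<cdot>\<^sub>m mat_unit N s t"
        using insert.hyps p by (auto simp: y_def mat_unit_def intro!: eq_matI)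
      then show ?thesis using add[OF yA[of X], of s t] insert st True by (simp add: N_def)
    next
      case False
      have "y (insert p X) = y X"
        using x0[OF st False] p by (auto simp: y_def intro!: eq_matI)
      then show ?thesis using insert by simp
    qed
  qed
  from this[of "{..<N} \<times> {..<N}"] have "P (y ({..<N} \<times> {..<N}))" by simp
  moreover have "y ({..<N} \<times> {..<N}) = x" using xc by (auto simp: y_def)
  ultimately show ?thesis by simp
qed

section \<open>Entries of the adjusted Choi matrix\<close>

lemma adjusted_choi_entries:
  assumes lin: "linear_on_block_alg l n m \<phi>"
  defines "N \<equiv> block_dim l n"
  shows "adjusted_choi l n m \<phi> \<in> carrier_mat (m * N) (m * N)"
    and "\<alpha> < m \<Longrightarrow> \<beta> < m \<Longrightarrow> s < N \<Longrightarrow> t < N \<Longrightarrow>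
      adjusted_choi l n m \<phi> $$ (\<alpha> * N + s, \<beta> * N + t) = (if block_of n s = block_of n t
        then 1 / of_nat (n (block_of n s)) * \<phi> (mat_unit N s t) $$ (\<alpha>, \<beta>) else 0)"
proof -
  let ?V = "module_mat TYPE(complex) (m * N) (m * N)"
  define K where "K k i j = (1 / of_nat (n k)) \<cdot>\<^sub>m kron (\<phi> (block_unit l n i j k)) (block_unit l n i j k)"
    for k i j
  have bu: "block_unit l n i j k \<in> block_alg l n" if "k < l" "i < n k" "j < n k" for k i j
    using that by (simp add: block_unit_eq_mat_unit block_alg_mat_unit offset_less block_of_offset)
  have \<phi>bu: "\<phi> (block_unit l n i j k) \<in> carrier_mat m m" if "k < l" "i < n k" "j < n k" for k i j
    using lin bu[OF that] by (simp add: linear_on_block_alg_def)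
  have buc: "block_unit l n i j k \<in> carrier_mat N N" if "k < l" "i < n k" "j < n k" for k i j
    using block_alg_carrier[OF bu[OF that]] by (simp add: N_def)
  have K: "K k i j \<in> carrier_mat (m * N) (m * N)" if "k < l" "i < n k" "j < n k" for k i j
    unfolding K_def using kron_carrier[OF \<phi>bu[OF that] buc[OF that]] by simp
  have choi: "adjusted_choi l n m \<phi>
      = (\<Oplus>\<^bsub>?V\<^esub> k \<in> {..<l}. \<Oplus>\<^bsub>?V\<^esub> i \<in> {..<n k}. \<Oplus>\<^bsub>?V\<^esub> j \<in> {..<n k}. K k i j)"
    by (simp add: adjusted_choi_def K_def N_def Let_def)
  show "adjusted_choi l n m \<phi> \<in> carrier_mat (m * N) (m * N)"
    unfolding choi by (intro finsum_mat_closed) (auto intro: K)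
  assume ab: "\<alpha> < m" "\<beta> < m" and st: "s < N" "t < N"
  obtain k0 i0 where s: "k0 < l" "i0 < n k0" "s = block_dim k0 n + i0"
    using st(1) unfolding N_def by (rule block_dim_cases)
  obtain k1 j0 where t: "k1 < l" "j0 < n k1" "t = block_dim k1 n + j0"
    using st(2) unfolding N_def by (rule block_dim_cases)
  define I J where "I = \<alpha> * N + s" and "J = \<beta> * N + t"
  have IJ: "I < m * N" "J < m * N" using ab st by (auto simp: I_def J_def mult_add_less)
  have "adjusted_choi l n m \<phi> $$ (I, J) = (\<Sum>k<l. \<Sum>i<n k. \<Sum>j<n k. K k i j $$ (I, J))"
  proof -
    have 1: "(\<Oplus>\<^bsub>?V\<^esub> j \<in> {..<n k}. K k i j) $$ (I, J) = (\<Sum>j<n k. K k i j $$ (I, J))"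
      "(\<Oplus>\<^bsub>?V\<^esub> j \<in> {..<n k}. K k i j) \<in> carrier_mat (m * N) (m * N)"
      if "k < l" "i < n k" for k i
      by (rule index_finsum_mat finsum_mat_closed; use K that IJ in auto)+
    have 2: "(\<Oplus>\<^bsub>?V\<^esub> i \<in> {..<n k}. \<Oplus>\<^bsub>?V\<^esub> j \<in> {..<n k}. K k i j) $$ (I, J)
        = (\<Sum>i<n k. (\<Oplus>\<^bsub>?V\<^esub> j \<in> {..<n k}. K k i j) $$ (I, J))"
      "(\<Oplus>\<^bsub>?V\<^esub> i \<in> {..<n k}. \<Oplus>\<^bsub>?V\<^esub> j \<in> {..<n k}. K k i j) \<in> carrier_mat (m * N) (m * N)"
      if "k < l" for k
      by (rule index_finsum_mat finsum_mat_closed; use 1 that IJ in auto)+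
    have "adjusted_choi l n m \<phi> $$ (I, J)
        = (\<Sum>k<l. (\<Oplus>\<^bsub>?V\<^esub> i \<in> {..<n k}. \<Oplus>\<^bsub>?V\<^esub> j \<in> {..<n k}. K k i j) $$ (I, J))"
      unfolding choi by (rule index_finsum_mat; use 2 IJ in auto)
    then show ?thesis by (simp add: 1 2)
  qed
  also have "\<dots> = (\<Sum>k<l. \<Sum>i<n k. \<Sum>j<n k. if j = j0 then if i = i0 then if k = k0 then if k0 = k1
      then 1 / of_nat (n k0) * \<phi> (mat_unit N s t) $$ (\<alpha>, \<beta>) else 0 else 0 else 0 else 0)"
  proof (intro sum.cong refl)
    fix k i j assume "k \<in> {..<l}" "i \<in> {..<n k}" "j \<in> {..<n k}"
    then have kij: "k < l" "i < n k" "j < n k" by auto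
    have "K k i j $$ (I, J)
      = 1 / of_nat (n k) * (\<phi> (block_unit l n i j k) $$ (\<alpha>, \<beta>) * block_unit l n i j k $$ (s, t))"
      using kron_carrier[OF \<phi>bu[OF kij] buc[OF kij]] IJ
        index_kron[OF \<phi>bu[OF kij] buc[OF kij] ab st]
      unfolding K_def I_def J_def by simp
    also have "\<dots> = (if j = j0 then if i = i0 then if k = k0 then if k0 = k1
      then 1 / of_nat (n k0) * \<phi> (mat_unit N s t) $$ (\<alpha>, \<beta>) else 0 else 0 else 0 else 0)"
    proof -
      have "s = block_dim k n + i \<longleftrightarrow> k0 = k \<and> i0 = i" "t = block_dim k n + j \<longleftrightarrow> k1 = k \<and> j0 = j"
        unfolding s(3) t(3) using kij s t by (simp_all only: offset_eq_iff)
      then have "block_unit l n i j k $$ (s, t) = (if (k0 = k \<and> i0 = i) \<and> k1 = k \<and> j0 = j then 1 else 0)"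
        using st unfolding block_unit_eq_mat_unit[of k l i n j, OF kij] N_def by (simp add: index_mat_unit)
      moreover have "block_unit l n i j k = mat_unit N s t" if "(k0 = k \<and> i0 = i) \<and> k1 = k \<and> j0 = j"
        unfolding block_unit_eq_mat_unit[of k l i n j, OF kij] s(3) t(3) using that by (simp add: N_def)
      ultimately show ?thesis by auto
    qed
    finally show "K k i j $$ (I, J) = (if j = j0 then if i = i0 then if k = k0 then if k0 = k1
      then 1 / of_nat (n k0) * \<phi> (mat_unit N s t) $$ (\<alpha>, \<beta>) else 0 else 0 else 0 else 0)" .
  qed
  also have "\<dots> = (\<Sum>k<l. if k = k0 then if k0 = k1
      then 1 / of_nat (n k0) * \<phi> (mat_unit N s t) $$ (\<alpha>, \<beta>) else 0 else 0)"
    using s t by (intro sum.cong refl) auto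
  also have "\<dots> = (if block_of n s = block_of n t
        then 1 / of_nat (n (block_of n s)) * \<phi> (mat_unit N s t) $$ (\<alpha>, \<beta>) else 0)"
    using s(1) block_of_offset[of i0 n k0, OF s(2)] block_of_offset[of j0 n k1, OF t(2)]
    by (simp flip: s(3) t(3))
  finally show "adjusted_choi l n m \<phi> $$ (\<alpha> * N + s, \<beta> * N + t) = (if block_of n s = block_of n t
        then 1 / of_nat (n (block_of n s)) * \<phi> (mat_unit N s t) $$ (\<alpha>, \<beta>) else 0)"
    by (simp add: I_def J_def)
qed

section \<open>Null vectors of semidefinite forms\<close>

text \<open>Near \<open>t = 0\<close> the linear term dominates, and it changes sign with \<open>t\<close>.\<close>

lemma linear_coefficient_zero:
  fixes w d :: complex
  assumes "\<And>t::real. 0 \<le> of_real t * w + of_real (t\<^sup>2) * d"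
  shows "w = 0"
proof -
  have im: "0 = t * Im w + t\<^sup>2 * Im d" and re: "0 \<le> t * Re w + t\<^sup>2 * Re d" for t
    using assms[of t] by (auto simp: less_eq_complex_def)
  have "Im w = 0" using im[of 1] im[of "-1"] by simp
  moreover have "Re w = 0"
  proof (rule ccontr)
    assume "Re w \<noteq> 0"
    define D where "D = \<bar>Re d\<bar> + 1"
    \<comment> \<open>At this point the linear term is \<open>- t\<^sup>2 D\<close>, and \<open>D\<close> exceeds the quadratic coefficient.\<close>
    define t where "t = - Re w / D"
    have D: "D > 0" "Re d < D" by (auto simp: D_def)
    have t: "t \<noteq> 0" using \<open>Re w \<noteq> 0\<close> D by (simp add: t_def)
    have "t * Re w = - (t\<^sup>2 * D)" using D by (simp add: t_def power2_eq_square)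
    moreover have "t\<^sup>2 * Re d < t\<^sup>2 * D" using D t by (intro mult_strict_left_mono) auto
    ultimately show False using re[of t] by simp
  qed
  ultimately show ?thesis by (simp add: complex_eq_iff)
qed

text \<open>The equality case of the Cauchy-Schwarz inequality, proved from \<open>g (x + c y) (x + c y) \<ge> 0\<close> for real
and for purely imaginary \<open>c\<close>, which show that \<open>g x y + g y x\<close> and \<open>g x y - g y x\<close> vanish.  The argument \<open>plus\<close> stands
for the operation \<open>x + c y\<close>, so that \<open>S\<close> may be a subspace of a type without vector space structure,
such as the matrices of all sizes.\<close>

lemma semidefinite_form_null:
  fixes g :: "'a \<Rightarrow> 'a \<Rightarrow> complex" and plus :: "'a \<Rightarrow> complex \<Rightarrow> 'a \<Rightarrow> 'a"
  assumes left: "\<And>x y z c. x \<in> S \<Longrightarrow> y \<in> S \<Longrightarrow> z \<in> S \<Longrightarrow> g (plus x c y) z = g x z + c * g y z"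
    and right: "\<And>x y z c. x \<in> S \<Longrightarrow> y \<in> S \<Longrightarrow> z \<in> S \<Longrightarrow> g z (plus x c y) = g z x + cnj c * g z y"
    and closed: "\<And>x y c. x \<in> S \<Longrightarrow> y \<in> S \<Longrightarrow> plus x c y \<in> S"
    and nonneg: "\<And>x. x \<in> S \<Longrightarrow> 0 \<le> g x x"
    and x: "x \<in> S" "g x x = 0" and y: "y \<in> S"
  shows "g x y = 0"
proof -
  have exp: "0 \<le> cnj c * g x y + c * g y x + c * cnj c * g y y" for c
    using nonneg[OF closed[OF x(1) y, of c]] x y
    by (simp add: left right closed algebra_simps)
  have "g x y + g y x = 0"
  proof (rule linear_coefficient_zero[of _ "g y y"])
    fix t :: real
    show "0 \<le> of_real t * (g x y + g y x) + of_real (t\<^sup>2) * g y y"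
      using exp[of "of_real t"] by (simp add: algebra_simps power2_eq_square)
  qed
  moreover have "\<i> * g y x - \<i> * g x y = 0"
  proof (rule linear_coefficient_zero[of _ "g y y"])
    fix t :: real
    have "\<i> * of_real t * cnj (\<i> * of_real t) = of_real (t\<^sup>2)"
      by (simp add: complex_eq_iff power2_eq_square)
    then show "0 \<le> of_real t * (\<i> * g y x - \<i> * g x y) + of_real (t\<^sup>2) * g y y"
      using exp[of "\<i> * of_real t"] by (simp add: algebra_simps)
  qed
  ultimately show ?thesis by (simp add: complex_eq_iff)
qed

section \<open>Multiplicative domains of completely positive contractions\<close>

locale cp_contraction =
  fixes l m :: nat and n :: "nat \<Rightarrow> nat" and \<phi> :: "complex mat \<Rightarrow> complex mat"
  assumes lin: "linear_on_block_alg l n m \<phi>"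
    and cp: "completely_positive l n m \<phi>"
    and cc: "completely_contractive l n m \<phi>"
begin

abbreviation "N \<equiv> block_dim l n"
abbreviation "\<A> \<equiv> block_alg l n"

lemma map_carrier: "x \<in> \<A> \<Longrightarrow> \<phi> x \<in> carrier_mat m m"
  using lin by (simp add: linear_on_block_alg_def)

lemma map_add: "x \<in> \<A> \<Longrightarrow> y \<in> \<A> \<Longrightarrow> \<phi> (x + y) = \<phi> x + \<phi> y"
  using lin by (simp add: linear_on_block_alg_def)

lemma map_smult: "x \<in> \<A> \<Longrightarrow> \<phi> (c \<cdot>\<^sub>m x) = c \<cdot>\<^sub>m \<phi> x"
  using lin by (simp add: linear_on_block_alg_def)

lemma map_zero: "\<phi> (0\<^sub>m N N) = 0\<^sub>m m m"
proof -
  have "0 \<cdot>\<^sub>m X = 0\<^sub>m m m" if "X \<in> carrier_mat m m" for X :: "complex mat"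
    using that by (intro eq_matI) auto
  then show ?thesis
    using map_smult[OF block_alg_zero, of 0] map_carrier[OF block_alg_zero] by simp
qed

text \<open>The \<open>2 \<times> 2\<close> matrix with rows \<open>(a a\<^sup>*, a)\<close> and \<open>(a\<^sup>*, 1)\<close> is positive, because its quadratic form at
\<open>(x, y)\<close> is the squared norm of \<open>a\<^sup>* x + y\<close>.  The statement is the positivity of its image under
\<open>\<phi> \<otimes> id\<close>.\<close>

lemma two_positivity:
  assumes a: "a \<in> \<A>" and v: "v \<in> carrier_vec m" and w: "w \<in> carrier_vec m"
  shows "0 \<le> (\<phi> (a * mat_adjoint a) *\<^sub>v v) \<bullet>c v + (\<phi> a *\<^sub>v w) \<bullet>c v
    + (\<phi> (mat_adjoint a) *\<^sub>v v) \<bullet>c w + (\<phi> (1\<^sub>m N) *\<^sub>v w) \<bullet>c w"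
proof -
  define b where "b = (\<lambda>(p :: nat) (q :: nat). if p = 0 then if q = 0 then a * mat_adjoint a else a
    else if q = 0 then mat_adjoint a else 1\<^sub>m N)"
  have bA: "b p q \<in> \<A>" for p q
    using a by (auto simp: b_def intro: block_alg_mult block_alg_adjoint block_alg_one)
  have sum2: "(\<Sum>p<2. \<Sum>q<2. f p q) = f 0 0 + f 0 1 + f 1 0 + f 1 1" for f :: "nat \<Rightarrow> nat \<Rightarrow> complex"
    by (simp add: numeral_2_eq_2)
  have ac: "a \<in> carrier_mat N N" using a by (rule block_alg_carrier)
  note ac' = adjoint_carrier[OF ac]
  have "positive_mat (tensor_mat N 2 b)"
  proof (subst positive_tensor_mat_iff)
    show "\<forall>x. (\<forall>p<2. x p \<in> carrier_vec N) \<longrightarrow> 0 \<le> (\<Sum>p<2. \<Sum>q<2. (b p q *\<^sub>v x q) \<bullet>c x p)"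
    proof (intro allI impI)
      fix x :: "nat \<Rightarrow> complex vec" assume "\<forall>p<2. x p \<in> carrier_vec N"
      then have x: "x 0 \<in> carrier_vec N" "x 1 \<in> carrier_vec N" by auto
      define y where "y = mat_adjoint a *\<^sub>v x 0"
      have y: "y \<in> carrier_vec N" using ac' x by (simp add: y_def)
      have "(\<Sum>p<2. \<Sum>q<2. (b p q *\<^sub>v x q) \<bullet>c x p)
          = (a *\<^sub>v y) \<bullet>c x 0 + (a *\<^sub>v x 1) \<bullet>c x 0 + y \<bullet>c x 1 + x 1 \<bullet>c x 1"
        unfolding sum2 using ac ac' x by (simp add: b_def y_def assoc_mult_mat_vec[of _ N N])
      also have "\<dots> = y \<bullet>c y + x 1 \<bullet>c y + y \<bullet>c x 1 + x 1 \<bullet>c x 1"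
        using cscalar_adjoint[OF ac y x(1)] cscalar_adjoint[OF ac x(2) x(1)] by (simp add: y_def)
      also have "\<dots> = (y + x 1) \<bullet>c (y + x 1)"
        using x y by (simp add: conjugate_add_vec[of _ N] add_scalar_prod_distrib[of _ N]
            scalar_prod_add_distrib[of _ N])
      finally show "0 \<le> (\<Sum>p<2. \<Sum>q<2. (b p q *\<^sub>v x q) \<bullet>c x p)"
        by (simp only: conjugate_square_ge_0_vec)
    qed
  qed (use bA block_alg_carrier in auto)
  then have "positive_mat (tensor_mat m 2 (\<lambda>p q. \<phi> (b p q)))"
    using cp bA unfolding completely_positive_def by (auto dest!: spec[of _ "2::nat"])
  then have "\<forall>x. (\<forall>p<2. x p \<in> carrier_vec m) \<longrightarrow> 0 \<le> (\<Sum>p<2. \<Sum>q<2. (\<phi> (b p q) *\<^sub>v x q) \<bullet>c x p)"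
    by (subst (asm) positive_tensor_mat_iff) (auto intro: map_carrier bA)
  from this[rule_format, of "\<lambda>p. if p = 0 then v else w"] show ?thesis
    using v w unfolding sum2 by (simp add: b_def)
qed

text \<open>A positive form is real.  Scaling \<open>w\<close> by \<open>0, 1, -1, \<i>, -\<i>\<close> in \<open>two_positivity\<close> isolates its two mixed terms
and shows that they are conjugate to each other.\<close>

lemma map_adjoint:
  assumes a: "a \<in> \<A>"
  shows "\<phi> (mat_adjoint a) = mat_adjoint (\<phi> a)"
proof -
  have pc: "\<phi> a \<in> carrier_mat m m" and pc': "\<phi> (mat_adjoint a) \<in> carrier_mat m m"
    and pc1: "\<phi> (1\<^sub>m N) \<in> carrier_mat m m" and pcaa: "\<phi> (a * mat_adjoint a) \<in> carrier_mat m m"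
    using a by (auto intro!: map_carrier block_alg_adjoint block_alg_one block_alg_mult)
  have herm: "(\<phi> (mat_adjoint a) *\<^sub>v v) \<bullet>c w = cnj ((\<phi> a *\<^sub>v w) \<bullet>c v)"
    if v: "v \<in> carrier_vec m" and w: "w \<in> carrier_vec m" for v w
  proof -
    define p q d e where pq: "p = (\<phi> a *\<^sub>v w) \<bullet>c v" "q = (\<phi> (mat_adjoint a) *\<^sub>v v) \<bullet>c w"
      and de: "d = (\<phi> (a * mat_adjoint a) *\<^sub>v v) \<bullet>c v" "e = (\<phi> (1\<^sub>m N) *\<^sub>v w) \<bullet>c w"
    have pos: "0 \<le> d + c * p + cnj c * q + c * cnj c * e" for c
      using two_positivity[OF a v, of "c \<cdot>\<^sub>v w"] v w pc pc' pc1 pcaa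
      by (simp add: pq de mult_mat_vec[of _ m m] conjugate_smult_vec algebra_simps)
    show ?thesis
      using pos[of 0] pos[of 1] pos[of "-1"] pos[of \<i>] pos[of "-\<i>"]
      by (simp add: pq[symmetric] less_eq_complex_def complex_eq_iff)
  qed
  show ?thesis
  proof (rule eq_matI)
    fix i j assume "i < dim_row (mat_adjoint (\<phi> a))" "j < dim_col (mat_adjoint (\<phi> a))"
    then have ij: "i < m" "j < m" using pc adjoint_carrier[OF pc] by auto
    show "\<phi> (mat_adjoint a) $$ (i, j) = mat_adjoint (\<phi> a) $$ (i, j)"
      using herm[of "unit_vec m j" "unit_vec m i"] ij
      by (simp add: cscalar_mat_unit_vec[OF pc'] cscalar_mat_unit_vec[OF pc] index_adjoint[OF pc])
  qed (use pc' adjoint_carrier[OF pc] in auto)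
qed

text \<open>The norm bound for \<open>r = 1\<close> at the unit gives \<open>op_norm (\<phi> 1) \<le> 1\<close>; for the positive matrix \<open>\<phi> 1\<close> this
means \<open>\<phi> 1 \<le> 1\<close>.\<close>

lemma map_one_le:
  assumes w: "w \<in> carrier_vec m"
  shows "(\<phi> (1\<^sub>m N) *\<^sub>v w) \<bullet>c w \<le> w \<bullet>c w"
proof -
  let ?P = "\<phi> (1\<^sub>m N)"
  have P: "?P \<in> carrier_mat m m" by (intro map_carrier block_alg_one)
  have "op_norm (tensor_mat m 1 (\<lambda>p q. ?P)) \<le> op_norm (tensor_mat N 1 (\<lambda>p q. 1\<^sub>m N))"
    using cc block_alg_one[of l n] unfolding completely_contractive_def
    by (auto dest!: spec[of _ "1::nat"] dest: spec[of _ "\<lambda>p q. 1\<^sub>m N"])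
  then have norm: "op_norm ?P \<le> 1"
    using op_norm_one_le[of N] P by (simp add: tensor_mat_1[of _ N] tensor_mat_1[of _ m] del: One_nat_def)
  have nn: "0 \<le> l2_norm w" by (simp add: l2_norm_def)
  have "cmod ((?P *\<^sub>v w) \<bullet>c w) \<le> l2_norm (?P *\<^sub>v w) * l2_norm w"
    using P w by (intro norm_cscalar_le) auto
  also have "\<dots> \<le> (1 * l2_norm w) * l2_norm w"
    using l2_norm_mult_mat_vec_le[OF P w] norm nn
    by (meson mult_right_mono order_trans)
  finally have *: "cmod ((?P *\<^sub>v w) \<bullet>c w) \<le> (l2_norm w)\<^sup>2" by (simp add: power2_eq_square)
  have "0\<^sub>m m m *\<^sub>v u = 0\<^sub>v m" if "u \<in> carrier_vec m" for u :: "complex vec"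
    using that by (intro eq_vecI) auto
  then have "0 \<le> (?P *\<^sub>v w) \<bullet>c w"
    using two_positivity[OF block_alg_zero, of "0\<^sub>v m" w] w P
    by (simp add: adjoint_zero map_zero)
  then show ?thesis
    using * complex_Re_le_cmod[of "(?P *\<^sub>v w) \<bullet>c w"]
    unfolding cscalar_self by (simp add: less_eq_complex_def)
qed

text \<open>The failure of \<open>\<phi> (a b\<^sup>*) = \<phi> a (\<phi> b)\<^sup>*\<close>, evaluated at a vector so that it becomes a scalar
sesquilinear form in \<open>(a, b)\<close>.\<close>

definition defect :: "complex vec \<Rightarrow> complex mat \<Rightarrow> complex mat \<Rightarrow> complex" where
  "defect v a b = (\<phi> (a * mat_adjoint b) *\<^sub>v v) \<bullet>c v - ((\<phi> a * mat_adjoint (\<phi> b)) *\<^sub>v v) \<bullet>c v"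

text \<open>Choosing \<open>w = - (\<phi> a)\<^sup>* v\<close> makes both mixed terms of \<open>two_positivity\<close> equal to minus the squared norm
of \<open>w\<close>, while the term with \<open>\<phi> 1\<close> gives back at most one such square.\<close>

lemma Kadison_Schwarz:
  assumes a: "a \<in> \<A>" and v: "v \<in> carrier_vec m"
  shows "0 \<le> defect v a a"
proof -
  have pc: "\<phi> a \<in> carrier_mat m m" by (rule map_carrier[OF a])
  define w where "w = mat_adjoint (\<phi> a) *\<^sub>v v"
  have w: "w \<in> carrier_vec m" using adjoint_carrier[OF pc] v by (simp add: w_def)
  have pcaa: "\<phi> (a * mat_adjoint a) \<in> carrier_mat m m"
    using a by (intro map_carrier block_alg_mult block_alg_adjoint)
  have P: "\<phi> (1\<^sub>m N) \<in> carrier_mat m m" by (intro map_carrier block_alg_one)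
  have 1: "(\<phi> a *\<^sub>v w) \<bullet>c v = w \<bullet>c w"
    using cscalar_adjoint[OF pc w v] by (simp add: w_def)
  have "0 \<le> (\<phi> (a * mat_adjoint a) *\<^sub>v v) \<bullet>c v + (\<phi> a *\<^sub>v ((-1) \<cdot>\<^sub>v w)) \<bullet>c v
    + (\<phi> (mat_adjoint a) *\<^sub>v v) \<bullet>c ((-1) \<cdot>\<^sub>v w) + (\<phi> (1\<^sub>m N) *\<^sub>v ((-1) \<cdot>\<^sub>v w)) \<bullet>c ((-1) \<cdot>\<^sub>v w)"
    by (rule two_positivity[OF a v]) (use w in simp)
  also have "\<dots> = (\<phi> (a * mat_adjoint a) *\<^sub>v v) \<bullet>c v - 2 * (w \<bullet>c w) + (\<phi> (1\<^sub>m N) *\<^sub>v w) \<bullet>c w"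
    using v w pc P 1
    by (simp add: map_adjoint[OF a] w_def[symmetric] mult_mat_vec[of _ m m] conjugate_smult_vec)
  also have "\<dots> \<le> (\<phi> (a * mat_adjoint a) *\<^sub>v v) \<bullet>c v - 2 * (w \<bullet>c w) + w \<bullet>c w"
    using map_one_le[OF w] by (rule add_left_mono)
  also have "\<dots> = defect v a a"
    unfolding defect_def using pc adjoint_carrier[OF pc] v
    by (simp add: assoc_mult_mat_vec[of _ m m] w_def[symmetric] 1)
  finally show ?thesis .
qed

lemma defect_left:
  assumes "x \<in> \<A>" "y \<in> \<A>" "z \<in> \<A>" and v: "v \<in> carrier_vec m"
  shows "defect v (x + c \<cdot>\<^sub>m y) z = defect v x z + c * defect v y z"
proof -
  note C = block_alg_carrier[OF assms(1)] block_alg_carrier[OF assms(2)]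
    adjoint_carrier[OF block_alg_carrier[OF assms(3)]]
  note PC = map_carrier[OF assms(1)] map_carrier[OF assms(2)] adjoint_carrier[OF map_carrier[OF assms(3)]]
  have xz: "x * mat_adjoint z \<in> \<A>" and yz: "y * mat_adjoint z \<in> \<A>"
    using assms by (auto intro!: block_alg_mult block_alg_adjoint)
  have "(x + c \<cdot>\<^sub>m y) * mat_adjoint z = x * mat_adjoint z + c \<cdot>\<^sub>m (y * mat_adjoint z)"
    using C by (simp add: add_mult_distrib_mat[of _ N N] mult_smult_assoc_mat[of _ N N])
  then have 1: "\<phi> ((x + c \<cdot>\<^sub>m y) * mat_adjoint z) = \<phi> (x * mat_adjoint z) + c \<cdot>\<^sub>m \<phi> (y * mat_adjoint z)"
    using xz yz by (simp add: map_add map_smult block_alg_smult)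
  have "\<phi> (x + c \<cdot>\<^sub>m y) = \<phi> x + c \<cdot>\<^sub>m \<phi> y"
    using assms by (simp add: map_add map_smult block_alg_smult)
  then have 2: "\<phi> (x + c \<cdot>\<^sub>m y) * mat_adjoint (\<phi> z)
      = \<phi> x * mat_adjoint (\<phi> z) + c \<cdot>\<^sub>m (\<phi> y * mat_adjoint (\<phi> z))"
    using PC by (simp add: add_mult_distrib_mat[of _ m m] mult_smult_assoc_mat[of _ m m])
  show ?thesis
    unfolding defect_def 1 2
    using map_carrier[OF xz] map_carrier[OF yz] mult_carrier_mat[OF PC(1) PC(3)]
      mult_carrier_mat[OF PC(2) PC(3)] v
    by (simp only: cscalar_add_smult_mat) (simp add: algebra_simps)
qed

lemma defect_right:
  assumes "x \<in> \<A>" "y \<in> \<A>" "z \<in> \<A>" and v: "v \<in> carrier_vec m"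
  shows "defect v z (x + c \<cdot>\<^sub>m y) = defect v z x + cnj c * defect v z y"
proof -
  note C = block_alg_carrier[OF assms(1)] block_alg_carrier[OF assms(2)] block_alg_carrier[OF assms(3)]
  note C' = adjoint_carrier[OF C(1)] adjoint_carrier[OF C(2)]
  note PC = map_carrier[OF assms(1)] map_carrier[OF assms(2)] map_carrier[OF assms(3)]
  note PC' = adjoint_carrier[OF PC(1)] adjoint_carrier[OF PC(2)]
  have zx: "z * mat_adjoint x \<in> \<A>" and zy: "z * mat_adjoint y \<in> \<A>"
    using assms by (auto intro!: block_alg_mult block_alg_adjoint)
  have "z * mat_adjoint (x + c \<cdot>\<^sub>m y) = z * mat_adjoint x + cnj c \<cdot>\<^sub>m (z * mat_adjoint y)"
    using C C' by (simp add: adjoint_add_smult[of _ N] mult_add_distrib_mat[of _ N N] mult_smult_distrib[of _ N N])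
  then have 1: "\<phi> (z * mat_adjoint (x + c \<cdot>\<^sub>m y)) = \<phi> (z * mat_adjoint x) + cnj c \<cdot>\<^sub>m \<phi> (z * mat_adjoint y)"
    using zx zy by (simp add: map_add map_smult block_alg_smult)
  have "\<phi> (x + c \<cdot>\<^sub>m y) = \<phi> x + c \<cdot>\<^sub>m \<phi> y"
    using assms by (simp add: map_add map_smult block_alg_smult)
  then have 2: "\<phi> z * mat_adjoint (\<phi> (x + c \<cdot>\<^sub>m y))
      = \<phi> z * mat_adjoint (\<phi> x) + cnj c \<cdot>\<^sub>m (\<phi> z * mat_adjoint (\<phi> y))"
    using PC PC' by (simp add: adjoint_add_smult[of _ m] mult_add_distrib_mat[of _ m m] mult_smult_distrib[of _ m m])
  show ?thesis
    unfolding defect_def 1 2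
    using map_carrier[OF zx] map_carrier[OF zy] mult_carrier_mat[OF PC(3) PC'(1)]
      mult_carrier_mat[OF PC(3) PC'(2)] v
    by (simp only: cscalar_add_smult_mat) (simp add: algebra_simps)
qed

text \<open>By \<open>semidefinite_form_null\<close> the defect form vanishes at \<open>(a, b\<^sup>*)\<close> for every vector, and a matrix is
determined by its quadratic form.\<close>

lemma multiplicative_domain:
  assumes a: "a \<in> \<A>" and eq: "\<And>v. v \<in> carrier_vec m \<Longrightarrow> defect v a a = 0" and b: "b \<in> \<A>"
  shows "\<phi> (a * b) = \<phi> a * \<phi> b"
proof (rule eq_mat_if_quadratic_forms_eq)
  show "\<phi> (a * b) \<in> carrier_mat m m" using a b by (intro map_carrier block_alg_mult)
  show "\<phi> a * \<phi> b \<in> carrier_mat m m" using mult_carrier_mat[OF map_carrier[OF a] map_carrier[OF b]] .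
  fix v :: "complex vec" assume v: "v \<in> carrier_vec m"
  have "defect v a (mat_adjoint b) = 0"
    by (rule semidefinite_form_null[where S = \<A> and g = "defect v" and plus = "\<lambda>x c y. x + c \<cdot>\<^sub>m y"])
      (use a b eq[OF v] v in \<open>auto simp: defect_left defect_right Kadison_Schwarz
        intro: block_alg_add block_alg_smult block_alg_adjoint\<close>)
  then show "(\<phi> (a * b) *\<^sub>v v) \<bullet>c v = ((\<phi> a * \<phi> b) *\<^sub>v v) \<bullet>c v"
    by (simp add: defect_def map_adjoint[OF b] adjoint_adjoint[OF block_alg_carrier[OF b]]
      adjoint_adjoint[OF map_carrier[OF b]])
qed

lemma multiplicative_if_multiplicative_on_units:
  assumes units: "\<And>s t b. s < N \<Longrightarrow> t < N \<Longrightarrow> block_of n s = block_of n t \<Longrightarrow> b \<in> \<A> \<Longrightarrow>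
      \<phi> (mat_unit N s t * b) = \<phi> (mat_unit N s t) * \<phi> b"
    and a: "a \<in> \<A>" and b: "b \<in> \<A>"
  shows "\<phi> (a * b) = \<phi> a * \<phi> b"
  using a
proof (induction a rule: block_alg_induct)
  case zero
  then show ?case using map_carrier[OF b] block_alg_carrier[OF b] map_zero by simp
next
  case (add y c s t)
  let ?E = "mat_unit N s t"
  have E: "?E \<in> \<A>" using add by (intro block_alg_mat_unit)
  note C = block_alg_carrier[OF add(1)] block_alg_carrier[OF E] block_alg_carrier[OF b]
  note PC = map_carrier[OF add(1)] map_carrier[OF E] map_carrier[OF b]
  have "(y + c \<cdot>\<^sub>m ?E) * b = y * b + c \<cdot>\<^sub>m (?E * b)"
    using C by (simp add: add_mult_distrib_mat[of _ N N] mult_smult_assoc_mat[of _ N N])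
  then have "\<phi> ((y + c \<cdot>\<^sub>m ?E) * b) = \<phi> y * \<phi> b + c \<cdot>\<^sub>m (\<phi> ?E * \<phi> b)"
    using add E b by (simp add: map_add map_smult block_alg_smult block_alg_mult units)
  also have "\<dots> = (\<phi> y + c \<cdot>\<^sub>m \<phi> ?E) * \<phi> b"
    using PC by (simp add: add_mult_distrib_mat[of _ m m] mult_smult_assoc_mat[of _ m m])
  finally show ?case using add E by (simp add: map_add map_smult block_alg_smult)
qed

section \<open>Idempotent adjusted Choi matrices\<close>

text \<open>In the square of the Choi matrix only the summands with \<open>u\<close> in the block of \<open>s\<close> and \<open>t\<close> survive.  They
carry the square of the weight that \<open>\<phi> E\<^sub>s\<^sub>t\<close> has in the Choi matrix itself, so clearing denominators
leaves one factor equal to the block size.\<close>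

lemma choi_idempotent_iff:
  "adjusted_choi l n m \<phi> * adjusted_choi l n m \<phi> = adjusted_choi l n m \<phi> \<longleftrightarrow>
    (\<forall>s<N. \<forall>t<N. block_of n s = block_of n t \<longrightarrow> (\<forall>\<alpha><m. \<forall>\<beta><m.
      (\<Sum>u | u < N \<and> block_of n u = block_of n s. (\<phi> (mat_unit N s u) * \<phi> (mat_unit N u t)) $$ (\<alpha>, \<beta>))
        = of_nat (n (block_of n s)) * \<phi> (mat_unit N s t) $$ (\<alpha>, \<beta>)))"
    (is "?C * ?C = ?C \<longleftrightarrow> ?R")
proof -
  note C = adjusted_choi_entries[OF lin]
  define B where "B s = {u. u < N \<and> block_of n u = block_of n s}" for s
  define k where "k s = (of_nat (n (block_of n s)) :: complex)" for s
  define F where "F s t = \<phi> (mat_unit N s t)" for s t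
  have F: "F s t \<in> carrier_mat m m" if "s < N" "t < N" "block_of n s = block_of n t" for s t
    unfolding F_def using that by (intro map_carrier block_alg_mat_unit)
  \<comment> \<open>A block that contains an index is nonempty, so its weight is invertible.\<close>
  have k0: "k s \<noteq> 0" if "s < N" for s
  proof -
    have "card (B s) = n (block_of n s)" unfolding B_def by (intro card_block block_of_less that)
    moreover have "s \<in> B s" "finite (B s)" using that by (auto simp: B_def)
    ultimately have "n (block_of n s) \<noteq> 0" by (metis card_0_eq empty_iff)
    then show ?thesis by (simp add: k_def)
  qed
  have sq: "(?C * ?C) $$ (\<alpha> * N + s, \<beta> * N + t) = (if block_of n s = block_of n t
      then (\<Sum>u\<in>B s. (F s u * F u t) $$ (\<alpha>, \<beta>)) / (k s)\<^sup>2 else 0)"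
    if ab: "\<alpha> < m" "\<beta> < m" and st: "s < N" "t < N" for \<alpha> \<beta> s t
  proof -
    have "(?C * ?C) $$ (\<alpha> * N + s, \<beta> * N + t)
        = (\<Sum>\<gamma><m. \<Sum>u<N. ?C $$ (\<alpha> * N + s, \<gamma> * N + u) * ?C $$ (\<gamma> * N + u, \<beta> * N + t))"
      using ab st by (subst index_mult_mat_sum[OF C(1) C(1)]) (auto simp: mult_add_less sum_lessThan_mult)
    also have "\<dots> = (\<Sum>u<N. \<Sum>\<gamma><m. ?C $$ (\<alpha> * N + s, \<gamma> * N + u) * ?C $$ (\<gamma> * N + u, \<beta> * N + t))"
      by (rule sum.swap)
    also have "\<dots> = (\<Sum>u<N. if u \<in> B s then if block_of n s = block_of n t
        then (F s u * F u t) $$ (\<alpha>, \<beta>) / (k s)\<^sup>2 else 0 else 0)"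
    proof (rule sum.cong[OF refl])
      fix u assume "u \<in> {..<N}"
      then have u: "u < N" by simp
      show "(\<Sum>\<gamma><m. ?C $$ (\<alpha> * N + s, \<gamma> * N + u) * ?C $$ (\<gamma> * N + u, \<beta> * N + t))
        = (if u \<in> B s then if block_of n s = block_of n t
        then (F s u * F u t) $$ (\<alpha>, \<beta>) / (k s)\<^sup>2 else 0 else 0)"
      proof (cases "u \<in> B s \<and> block_of n s = block_of n t")
        case True
        then have b: "block_of n s = block_of n u" "block_of n u = block_of n t" by (auto simp: B_def)
        have "(\<Sum>\<gamma><m. ?C $$ (\<alpha> * N + s, \<gamma> * N + u) * ?C $$ (\<gamma> * N + u, \<beta> * N + t))
          = (\<Sum>\<gamma><m. F s u $$ (\<alpha>, \<gamma>) * F u t $$ (\<gamma>, \<beta>) / (k s)\<^sup>2)"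
          using ab st u b by (intro sum.cong) (simp_all add: C(2) F_def k_def power2_eq_square)
        then show ?thesis
          using True index_mult_mat_sum[OF F[OF st(1) u b(1)] F[OF u st(2) b(2)] ab]
          by (simp add: sum_divide_distrib)
      next
        case False
        then have "block_of n s \<noteq> block_of n u \<or> block_of n u \<noteq> block_of n t"
          using u by (auto simp: B_def)
        then have "(\<Sum>\<gamma><m. ?C $$ (\<alpha> * N + s, \<gamma> * N + u) * ?C $$ (\<gamma> * N + u, \<beta> * N + t)) = 0"
          using ab st u by (intro sum.neutral) (auto simp: C(2))
        then show ?thesis using False by auto
      qed
    qed
    also have "\<dots> = (\<Sum>u\<in>B s. if block_of n s = block_of n t
        then (F s u * F u t) $$ (\<alpha>, \<beta>) / (k s)\<^sup>2 else 0)"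
      by (rule sum.mono_neutral_cong_right) (auto simp: B_def)
    finally show ?thesis by (simp add: sum_divide_distrib)
  qed
  have iff: "(?C * ?C) $$ (\<alpha> * N + s, \<beta> * N + t) = ?C $$ (\<alpha> * N + s, \<beta> * N + t) \<longleftrightarrow>
      (block_of n s = block_of n t \<longrightarrow>
        (\<Sum>u\<in>B s. (F s u * F u t) $$ (\<alpha>, \<beta>)) = k s * F s t $$ (\<alpha>, \<beta>))"
    if "\<alpha> < m" "\<beta> < m" "s < N" "t < N" for \<alpha> \<beta> s t
  proof -
    have "x / (k s)\<^sup>2 = 1 / k s * y \<longleftrightarrow> x = k s * y" for x y
      using k0[OF that(3)] by (simp add: field_simps power2_eq_square)
    then show ?thesis
      unfolding sq[OF that] C(2)[OF that] F_def[symmetric] k_def[symmetric] by simp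
  qed
  have "?C * ?C = ?C \<longleftrightarrow> (\<forall>\<alpha><m. \<forall>\<beta><m. \<forall>s<N. \<forall>t<N.
      (?C * ?C) $$ (\<alpha> * N + s, \<beta> * N + t) = ?C $$ (\<alpha> * N + s, \<beta> * N + t))" (is "_ \<longleftrightarrow> ?E")
  proof
    assume E: ?E
    show "?C * ?C = ?C"
    proof (rule eq_matI)
      fix I J assume "I < dim_row ?C" "J < dim_col ?C"
      then have IJ: "I < m * N" "J < m * N" using C(1) by auto
      then have "I div N < m" "J div N < m" "I mod N < N" "J mod N < N"
        by (auto simp: less_mult_imp_div_less intro!: mod_less_divisor Nat.gr0I)
      then show "(?C * ?C) $$ (I, J) = ?C $$ (I, J)"
        using E[rule_format, of "I div N" "J div N" "I mod N" "J mod N"]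
        by (simp only: div_mult_mod_eq)
    qed (use C(1) in auto)
  qed simp
  also have "\<dots> \<longleftrightarrow> (\<forall>s<N. \<forall>t<N. block_of n s = block_of n t \<longrightarrow> (\<forall>\<alpha><m. \<forall>\<beta><m.
      (\<Sum>u\<in>B s. (F s u * F u t) $$ (\<alpha>, \<beta>)) = k s * F s t $$ (\<alpha>, \<beta>)))"
    by (simp only: iff cong: imp_cong) meson
  finally show ?thesis unfolding B_def F_def k_def .
qed

lemma adjoint_choi: "mat_adjoint (adjusted_choi l n m \<phi>) = adjusted_choi l n m \<phi>"
proof (rule eq_matI)
  let ?C = "adjusted_choi l n m \<phi>"
  note C = adjusted_choi_entries[OF lin]
  fix I J assume "I < dim_row ?C" "J < dim_col ?C"
  then have IJ: "I < m * N" "J < m * N" using C(1) by auto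
  define \<alpha> s \<beta> t where I: "\<alpha> = I div N" "s = I mod N" and J: "\<beta> = J div N" "t = J mod N"
  have ab: "\<alpha> < m" "\<beta> < m" and st: "s < N" "t < N"
    using IJ by (auto simp: I J less_mult_imp_div_less intro!: mod_less_divisor Nat.gr0I)
  have IJ': "I = \<alpha> * N + s" "J = \<beta> * N + t" unfolding I J by (simp_all only: div_mult_mod_eq)
  have "\<phi> (mat_unit N s t) $$ (\<alpha>, \<beta>) = cnj (\<phi> (mat_unit N t s) $$ (\<beta>, \<alpha>))"
    if "block_of n s = block_of n t"
    using map_adjoint[OF block_alg_mat_unit[of t l n s]] that st ab
      index_adjoint[OF map_carrier[OF block_alg_mat_unit[of t l n s]], of \<alpha> \<beta>]
    by (simp add: adjoint_mat_unit)
  then show "mat_adjoint ?C $$ (I, J) = ?C $$ (I, J)"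
    unfolding index_adjoint[OF C(1) IJ] unfolding IJ' using ab st by (simp add: C(2))
qed (use adjusted_choi_entries(1)[OF lin] in \<open>auto simp: mat_adjoint_def\<close>)

text \<open>The block of \<open>s\<close> contributes as many defects as it has indices.  They are nonnegative by
Kadison-Schwarz, and by idempotency at \<open>t = s\<close> their sum is zero.\<close>

lemma defect_unit_zero:
  assumes idem: "adjusted_choi l n m \<phi> * adjusted_choi l n m \<phi> = adjusted_choi l n m \<phi>"
    and s: "s < N" and u: "u < N" "block_of n s = block_of n u" and v: "v \<in> carrier_vec m"
  shows "defect v (mat_unit N s u) (mat_unit N s u) = 0"
proof -
  define B where "B = {u. u < N \<and> block_of n u = block_of n s}"
  define F where "F s t = \<phi> (mat_unit N s t)" for s t
  have E: "mat_unit N s u \<in> \<A>" if "u \<in> B" for u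
    using that s by (intro block_alg_mat_unit) (auto simp: B_def)
  have F: "F s u * F u s \<in> carrier_mat m m" if "u \<in> B" for u
    unfolding F_def using that s
    by (intro mult_carrier_mat[where n = m] map_carrier block_alg_mat_unit) (auto simp: B_def)
  have Fs: "F s s \<in> carrier_mat m m"
    unfolding F_def using s by (intro map_carrier block_alg_mat_unit) auto
  have fin: "finite B" by (simp add: B_def)
  have card: "card B = n (block_of n s)" unfolding B_def by (intro card_block block_of_less s)
  have defect: "defect v (mat_unit N s u) (mat_unit N s u) = (F s s *\<^sub>v v) \<bullet>c v - ((F s u * F u s) *\<^sub>v v) \<bullet>c v"
    if "u \<in> B" for u
    using that map_adjoint[OF E[OF that]]
    by (simp add: defect_def F_def adjoint_mat_unit mat_unit_mult B_def)
  have idem': "(\<Sum>u\<in>B. (F s u * F u s) $$ (i, j)) = of_nat (card B) * F s s $$ (i, j)"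
    if "i < m" "j < m" for i j
    using idem[unfolded choi_idempotent_iff, rule_format, OF s s refl that]
    unfolding card unfolding B_def F_def .
  have "(\<Sum>u\<in>B. ((F s u * F u s) *\<^sub>v v) \<bullet>c v)
      = (\<Sum>u\<in>B. \<Sum>i<m. \<Sum>j<m. (F s u * F u s) $$ (i, j) * v $ j * cnj (v $ i))"
    by (intro sum.cong refl cscalar_mult_mat_vec F v)
  also have "\<dots> = (\<Sum>i<m. \<Sum>j<m. \<Sum>u\<in>B. (F s u * F u s) $$ (i, j) * v $ j * cnj (v $ i))"
    by (rule trans[OF sum.swap]) (rule sum.cong[OF refl], rule sum.swap)
  also have "\<dots> = (\<Sum>i<m. \<Sum>j<m. (\<Sum>u\<in>B. (F s u * F u s) $$ (i, j)) * v $ j * cnj (v $ i))"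
    by (simp only: sum_distrib_right)
  also have "\<dots> = (\<Sum>i<m. \<Sum>j<m. of_nat (card B) * F s s $$ (i, j) * v $ j * cnj (v $ i))"
    by (intro sum.cong refl) (simp add: idem' del: index_mult_mat)
  also have "\<dots> = of_nat (card B) * ((F s s *\<^sub>v v) \<bullet>c v)"
    unfolding cscalar_mult_mat_vec[OF Fs v v] by (simp add: sum_distrib_left mult.assoc)
  finally have "(\<Sum>u\<in>B. defect v (mat_unit N s u) (mat_unit N s u)) = 0"
    by (simp add: defect sum_subtractf)
  then have "\<forall>u\<in>B. defect v (mat_unit N s u) (mat_unit N s u) = 0"
    by (subst (asm) sum_nonneg_eq_0_iff[OF fin]) (auto intro: Kadison_Schwarz E v)
  then show ?thesis using u by (auto simp: B_def)
qed

end

theorem theorem2p3: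
  fixes l m :: nat and n :: "nat \<Rightarrow> nat" and \<phi> :: "complex mat \<Rightarrow> complex mat"
  assumes "l \<ge> 1" and "m \<ge> 1" and "\<forall>k<l. n k \<ge> 1"
    and "linear_on_block_alg l n m \<phi>"
    and "completely_positive l n m \<phi>"
    and "completely_contractive l n m \<phi>"
  shows "star_homomorphism l n m \<phi> \<longleftrightarrow> is_projection (adjusted_choi l n m \<phi>)"
proof -
  interpret cp_contraction l m n \<phi> using assms(4-6) by unfold_locales
  show ?thesis
  proof
    assume hom: "star_homomorphism l n m \<phi>"
    have "\<phi> (mat_unit N s u) * \<phi> (mat_unit N u t) = \<phi> (mat_unit N s t)"
      if "s < N" "t < N" "u < N" "block_of n u = block_of n s" "block_of n s = block_of n t" for s t u
    proof -
      have "mat_unit N s u \<in> \<A>" "mat_unit N u t \<in> \<A>"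
        using that by (auto intro: block_alg_mat_unit)
      then have "\<phi> (mat_unit N s u * mat_unit N u t) = \<phi> (mat_unit N s u) * \<phi> (mat_unit N u t)"
        using hom by (simp add: star_homomorphism_def)
      then show ?thesis using that by (simp add: mat_unit_mult)
    qed
    then have "adjusted_choi l n m \<phi> * adjusted_choi l n m \<phi> = adjusted_choi l n m \<phi>"
      unfolding choi_idempotent_iff by (simp add: card_block[OF block_of_less])
    then show "is_projection (adjusted_choi l n m \<phi>)"
      by (simp add: is_projection_def adjoint_choi)
  next
    assume "is_projection (adjusted_choi l n m \<phi>)"
    then have idem: "adjusted_choi l n m \<phi> * adjusted_choi l n m \<phi> = adjusted_choi l n m \<phi>"
      by (simp add: is_projection_def)
    have "\<phi> (mat_unit N s u * b) = \<phi> (mat_unit N s u) * \<phi> b"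
      if "s < N" "u < N" "block_of n s = block_of n u" "b \<in> \<A>" for s u b
      by (rule multiplicative_domain[OF block_alg_mat_unit[OF that(1-3)]
            defect_unit_zero[OF idem that(1-3)] that(4)])
    then have "\<phi> (x * y) = \<phi> x * \<phi> y" if "x \<in> \<A>" "y \<in> \<A>" for x y
      using that by (rule multiplicative_if_multiplicative_on_units)
    then show "star_homomorphism l n m \<phi>"
      using assms(4) by (simp add: star_homomorphism_def map_adjoint)
  qed
qed

end
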